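(* Let $M(\mathcal{O},\rho)$ be an irreducible Yetter-Drinfeld module over $\mathbb{C}\mathbb{A}_6$, corresponding to a pair $(\mathcal{O},\rho)$. If $\dim\mathfrak{B}(\mathcal{O},\rho)<\infty$, then $\mathcal{O}=\mathcal{O}_\pi$ is the conjugacy class in $\mathbb{A}_6$ of $\pi=(1\,2)(3\,4\,5\,6)$, and $\rho=\operatorname{sgn}$ is the character of $\mathbb{A}_6^\pi=\langle\pi\rangle\simeq\mathbb{Z}_4$ with $\operatorname{sgn}(\pi)=-1$.
   Context: Let $G$ be a finite group, $s\in G$, $\mathcal{O}$ the conjugacy class of $s$ in $G$, $G^s$ the centralizer of $s$ in $G$, and $\rho:G^s\to GL(V)$ an irreducible complex representation. List $\mathcal{O}=\{t_1=s,\dots,t_M\}$ and choose $g_i\in G$ with $g_isg_i^{-1}=t_i$. The irreducible Yetter-Drinfeld module $M(\mathcal{O},\rho)=\bigoplus_{i=1}^M g_i\otimes V$ over $\mathbb{C}G$ has, writing $g_iv:=g_i\otimes v$, coaction $\delta(g_iv)=t_i\otimes g_iv$ and action $g\cdot(g_iv)=g_j(\gamma\cdot v)$, where $gg_i=g_j\gamma$ with $\gamma\in G^s$. It is a braided vector space with braiding $c(g_iv\otimes g_jw)=t_i\cdot(g_jw)\otimes g_iv$. $\mathfrak{B}(\mathcal{O},\rho)$ denotes the Nichols algebra of this braided vector space. A pair $(\mathcal{O},\rho)$ is specified by the class of a representative $s$ and an irreducible representation (up to isomorphism) of $G^s$. *)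

theory Defs
  imports
    "HOL-Analysis.Analysis"
    "HOL-Algebra.Sym_Groups"
    "HOL-Algebra.Group_Action"
    "HOL-Algebra.QuotRing"
    "HOL-Algebra.Elementary_Groups"
begin

section \<open>Conjugacy classes, centralizers and matrix representations\<close>

definition conj_by :: "('a, 'm) monoid_scheme \<Rightarrow> 'a \<Rightarrow> 'a \<Rightarrow> 'a" where
  "conj_by G h x = h \<otimes>\<^bsub>G\<^esub> x \<otimes>\<^bsub>G\<^esub> inv\<^bsub>G\<^esub> h"

definition conj_class :: "('a, 'm) monoid_scheme \<Rightarrow> 'a \<Rightarrow> 'a set" where
  "conj_class G s = orbit G (conj_by G) s"

definition centralizer :: "('a, 'm) monoid_scheme \<Rightarrow> 'a \<Rightarrow> 'a set" where
  "centralizer G s = {x \<in> carrier G. x \<otimes>\<^bsub>G\<^esub> s = s \<otimes>\<^bsub>G\<^esub> x}"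

abbreviation centralizer_group :: "('a, 'm) monoid_scheme \<Rightarrow> 'a \<Rightarrow> ('a, 'm) monoid_scheme" where
  "centralizer_group G s \<equiv> G\<lparr>carrier := centralizer G s\<rparr>"

definition GL_group :: "(complex^'n^'n) monoid" where
  "GL_group = \<lparr>carrier = {A. invertible A}, mult = (**), one = mat 1\<rparr>"

definition complex_units :: "complex monoid" where
  "complex_units = \<lparr>carrier = UNIV - {0}, mult = (*), one = 1\<rparr>"

text \<open>
  The space \<open>complex^'n\<close> is nonzero for every index type, so the zero representation is
  excluded automatically.
\<close>

definition irreducible_rep :: "('a, 'm) monoid_scheme \<Rightarrow> ('a \<Rightarrow> complex^'n^'n) \<Rightarrow> bool" where
  "irreducible_rep H \<rho> \<longleftrightarrow> \<rho> \<in> hom H GL_group \<and>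
     (\<forall>W. vec.subspace W \<and> (\<forall>x\<in>carrier H. \<forall>v\<in>W. \<rho> x *v v \<in> W) \<longrightarrow> W = {0} \<or> W = UNIV)"

definition equivalent_reps ::
  "('a, 'm) monoid_scheme \<Rightarrow> ('a \<Rightarrow> complex^'n^'n) \<Rightarrow> ('a \<Rightarrow> complex^'k^'k) \<Rightarrow> bool" where
  "equivalent_reps H \<rho> \<sigma> \<longleftrightarrow>
     (\<exists>(P :: complex^'n^'k) (Q :: complex^'k^'n). P ** Q = mat 1 \<and> Q ** P = mat 1 \<and>
        (\<forall>x\<in>carrier H. P ** \<rho> x = \<sigma> x ** P))"

section \<open>The Yetter-Drinfeld module of a conjugacy class and a representation\<close>

text \<open>
  The class \<open>\<O>\<close> is indexed by itself: for \<open>t \<in> \<O>\<close>, \<open>g t\<close> is the chosen element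
  with \<open>g t s (g t)\<inverse> = t\<close>.
\<close>

definition conj_transversal :: "('a, 'm) monoid_scheme \<Rightarrow> 'a \<Rightarrow> ('a \<Rightarrow> 'a) \<Rightarrow> bool" where
  "conj_transversal G s g \<longleftrightarrow>
     (\<forall>t\<in>conj_class G s. g t \<in> carrier G \<and> conj_by G (g t) s = t)"

text \<open>
  An element of \<open>M(\<O>,\<rho>)\<close> is a function \<open>m\<close> supported on \<open>\<O>\<close>, standing for the sum of
  all \<open>g t \<otimes> m t\<close>; it is homogeneous of degree \<open>t\<close> for the coaction if it is supported at \<open>t\<close>.
  \<open>yd_elem t v\<close> is \<open>g t \<otimes> v\<close>.
\<close>

definition yd_elem :: "'a \<Rightarrow> complex^'n \<Rightarrow> ('a \<Rightarrow> complex^'n)" where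
  "yd_elem t v = (\<lambda>u. if u = t then v else 0)"

text \<open>
  In \<open>h (g t) = (g t') \<gamma>\<close> with \<open>\<gamma>\<close> in the centralizer of \<open>s\<close>, necessarily \<open>t' = h t h\<inverse>\<close> and
  \<open>\<gamma> = (g t')\<inverse> h (g t)\<close>.
\<close>

definition yd_action ::
  "('a, 'm) monoid_scheme \<Rightarrow> 'a \<Rightarrow> ('a \<Rightarrow> 'a) \<Rightarrow> ('a \<Rightarrow> complex^'n^'n) \<Rightarrow>
     'a \<Rightarrow> ('a \<Rightarrow> complex^'n) \<Rightarrow> ('a \<Rightarrow> complex^'n)" where
  "yd_action G s g \<rho> h m = (\<lambda>u. \<Sum>t\<in>conj_class G s.
     (let t' = conj_by G h t; \<gamma> = inv\<^bsub>G\<^esub> (g t') \<otimes>\<^bsub>G\<^esub> h \<otimes>\<^bsub>G\<^esub> g t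
      in yd_elem t' (\<rho> \<gamma> *v m t) u))"

text \<open>
  A braided vector space with finite basis \<open>X\<close> is given by the structure coefficients of its
  braiding: \<open>c x y (x', y')\<close> is the coefficient of \<open>x' \<otimes> y'\<close> in \<open>c(x \<otimes> y)\<close>.
  The basis of \<open>M(\<O>,\<rho>)\<close> consists of the pairs \<open>(t, k)\<close>, standing for \<open>g t \<otimes> e\<^sub>k\<close>, and the
  braiding is \<open>c(g t \<otimes> v, g u \<otimes> w) = t \<cdot> (g u \<otimes> w) \<otimes> (g t \<otimes> v)\<close>.
\<close>

type_synonym 'b braiding = "'b \<Rightarrow> 'b \<Rightarrow> 'b \<times> 'b \<Rightarrow> complex"

definition yd_basis :: "('a, 'm) monoid_scheme \<Rightarrow> 'a \<Rightarrow> ('a \<times> 'n::finite) set" where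
  "yd_basis G s = conj_class G s \<times> UNIV"

definition yd_braiding ::
  "('a, 'm) monoid_scheme \<Rightarrow> 'a \<Rightarrow> ('a \<Rightarrow> 'a) \<Rightarrow> ('a \<Rightarrow> complex^'n^'n) \<Rightarrow> ('a \<times> 'n) braiding" where
  "yd_braiding G s g \<rho> = (\<lambda>(t, k) (u, l) ((t', k'), y').
     yd_action G s g \<rho> t (yd_elem u (axis l 1)) t' $ k' * (if y' = (t, k) then 1 else 0))"

section \<open>Nichols algebras\<close>

text \<open>
  The tensor algebra \<open>T(V)\<close> on a space \<open>V\<close> with basis \<open>X\<close>: finitely supported functions on the
  words in \<open>X\<close>, with concatenation of words as multiplication.
\<close>

definition tensor_algebra :: "'b set \<Rightarrow> ('b list \<Rightarrow> complex) ring" where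
  "tensor_algebra X =
     \<lparr>carrier = {f. finite {w. f w \<noteq> 0} \<and> {w. f w \<noteq> 0} \<subseteq> lists X},
      mult = (\<lambda>f h w. \<Sum>k\<le>length w. f (take k w) * h (drop k w)),
      one = (\<lambda>w. if w = [] then 1 else 0),
      zero = (\<lambda>w. 0),
      add = (\<lambda>f h w. f w + h w)\<rparr>"

definition homogeneous_part :: "nat \<Rightarrow> ('b list \<Rightarrow> complex) \<Rightarrow> ('b list \<Rightarrow> complex)" where
  "homogeneous_part n f = (\<lambda>w. if length w = n then f w else 0)"

text \<open>
  \<open>braid_op X c i\<close> is the braiding applied to the tensor factors \<open>i\<close> and \<open>i + 1\<close> (counted from 0).
  It is only meant for tensors of degree at least \<open>i + 2\<close>.
\<close>

definition braid_op ::
  "'b set \<Rightarrow> 'b braiding \<Rightarrow> nat \<Rightarrow> ('b list \<Rightarrow> complex) \<Rightarrow> ('b list \<Rightarrow> complex)" where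
  "braid_op X c i f =
     (\<lambda>w. \<Sum>x\<in>X. \<Sum>y\<in>X. f (w[i := x, Suc i := y]) * c x y (w ! i, w ! Suc i))"

text \<open>
  A word \<open>is\<close> expresses the permutation \<open>\<sigma>\<close> of \<open>{0, \<dots>, n - 1}\<close> as a product of the adjacent
  transpositions \<open>(i i+1)\<close>, \<open>i \<in> is\<close>; it is reduced if its length is minimal.
\<close>

definition expresses :: "nat \<Rightarrow> (nat \<Rightarrow> nat) \<Rightarrow> nat list \<Rightarrow> bool" where
  "expresses n \<sigma> is \<longleftrightarrow> (\<forall>i\<in>set is. Suc i < n) \<and>
     foldr (\<lambda>i p. Transposition.transpose i (Suc i) \<circ> p) is id = \<sigma>"

definition reduced_word :: "nat \<Rightarrow> (nat \<Rightarrow> nat) \<Rightarrow> nat list" where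
  "reduced_word n \<sigma> = (ARG_MIN length is. expresses n \<sigma> is)"

text \<open>
  The Matsumoto lift of \<open>\<sigma>\<close> acting on tensors of degree \<open>n\<close>; for a solution \<open>c\<close> of the braid
  equation it does not depend on the choice of the reduced word.
\<close>

definition braid_lift ::
  "'b set \<Rightarrow> 'b braiding \<Rightarrow> nat \<Rightarrow> (nat \<Rightarrow> nat) \<Rightarrow> ('b list \<Rightarrow> complex) \<Rightarrow> ('b list \<Rightarrow> complex)" where
  "braid_lift X c n \<sigma> = foldr (\<lambda>i F. braid_op X c i \<circ> F) (reduced_word n \<sigma>) id"

definition quantum_symmetrizer ::
  "'b set \<Rightarrow> 'b braiding \<Rightarrow> nat \<Rightarrow> ('b list \<Rightarrow> complex) \<Rightarrow> ('b list \<Rightarrow> complex)" where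
  "quantum_symmetrizer X c n f = (\<lambda>w. \<Sum>\<sigma> | \<sigma> permutes {..<n}. braid_lift X c n \<sigma> f w)"

text \<open>
  The Nichols algebra is the quotient of \<open>T(V)\<close> by the direct sum of the kernels of the
  quantum symmetrizers.
\<close>

definition nichols_ideal :: "'b set \<Rightarrow> 'b braiding \<Rightarrow> ('b list \<Rightarrow> complex) set" where
  "nichols_ideal X c = {f \<in> carrier (tensor_algebra X).
     \<forall>n. quantum_symmetrizer X c n (homogeneous_part n f) = (\<lambda>w. 0)}"

definition nichols_algebra :: "'b set \<Rightarrow> 'b braiding \<Rightarrow> ('b list \<Rightarrow> complex) set ring" where
  "nichols_algebra X c = tensor_algebra X Quot nichols_ideal X c"

text \<open>
  The Nichols algebra is finite-dimensional if the classes of finitely many tensors span it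
  over \<open>\<complex>\<close>; linear combinations of classes are formed on representatives.
\<close>

definition nichols_finite_dim :: "'b set \<Rightarrow> 'b braiding \<Rightarrow> bool" where
  "nichols_finite_dim X c \<longleftrightarrow>
     (\<exists>F. finite F \<and> F \<subseteq> carrier (tensor_algebra X) \<and>
       (\<forall>u\<in>carrier (nichols_algebra X c). \<exists>a :: ('b list \<Rightarrow> complex) \<Rightarrow> complex.
          u = nichols_ideal X c +>\<^bsub>tensor_algebra X\<^esub> (\<lambda>w. \<Sum>f\<in>F. a f * f w)))"

section \<open>The exceptional class in the alternating group on six letters\<close>

definition pi_perm :: "nat \<Rightarrow> nat" where
  "pi_perm = cycle_of_list [1, 2] \<circ> cycle_of_list [3, 4, 5, 6]"

end

theory Submission
  imports
    Defs
    "HOL-Combinatorics.Multiset_Permutations"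
    "HOL-Algebra.Multiplicative_Group"
    "HOL-Computational_Algebra.Fundamental_Theorem_Algebra"
begin

text \<open>
  By Schur's lemma \<open>s\<close> acts on \<open>V\<close> by a scalar \<open>q\<close>. Every element of \<open>\<A>\<^sub>6\<close> is conjugate to its
  inverse, so for \<open>q\<^sup>2 \<noteq> 1\<close> the components of degrees \<open>s\<close> and \<open>s\<inverse>\<close> contain a diagonal braided plane of
  affine type \<open>A\<^sub>1\<^sup>(\<^sup>1\<^sup>)\<close>, while for \<open>q = 1\<close> a single vector spans a polynomial algebra. If
  \<open>q = -1\<close>, then \<open>s\<close> has even order; for \<open>s\<close> of type \<open>(a b)(c d)\<close> the three involutions of the Klein
  four-group on \<open>{a, b, c, d}\<close> have eigenvectors that span a braiding of affine type \<open>A\<^sub>2\<^sup>(\<^sup>1\<^sup>)\<close>. Only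
  the class of \<open>\<pi>\<close> remains.

  In all these diagonal cases an imaginary root vector \<open>u\<close>, whose braiding with itself is trivial, has
  nonzero powers: a suitable product \<open>P\<close> of skew derivations satisfies \<open>P (u f) = c f + u P f\<close> with
  \<open>c \<noteq> 0\<close> on the powers \<open>f\<close> of \<open>u\<close>, hence \<open>P\<^sup>n u\<^sup>n = n! c\<^sup>n\<close>.
\<close>

section \<open>Skew derivations on words\<close>

text \<open>The Nichols ideal is the graded kernel of the quantum symmetrizers, so it suffices to
  find, in arbitrarily high degree, one nonzero coordinate of a symmetrized tensor. For a diagonal
  braiding such a coordinate is a sum over arrangements weighted by their inversions, and removing
  the smallest position again and again turns it into a chain of skew derivations on the free
  algebra; this is where P comes from. The diagonal subspaces used here sit over pairwise commuting
  elements of the class. For q = -1 the pair s, s^-1 has edge label q^-2 = 1 and yields no affine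
  diagram, so three commuting conjugates with label -1 on every edge are sought. For \<pi> this
  fails: the only conjugates of \<pi> that commute with it are \<pi> and its inverse, and at q = -1
  they span just an exterior algebra's braiding.\<close>

definition skew_deriv :: "('i \<Rightarrow> 'i \<Rightarrow> complex) \<Rightarrow> 'i \<Rightarrow> ('i list \<Rightarrow> complex) \<Rightarrow> 'i list \<Rightarrow> complex" where
  "skew_deriv q a h w =
     (\<Sum>k\<le>length w. (\<Prod>b\<leftarrow>take k w. q b a) * h (take k w @ a # drop k w))"

definition letter_mult :: "'i \<Rightarrow> ('i list \<Rightarrow> complex) \<Rightarrow> 'i list \<Rightarrow> complex" where
  "letter_mult b h w = (case w of [] \<Rightarrow> 0 | c # w' \<Rightarrow> if c = b then h w' else 0)"

definition empty_word :: "'i list \<Rightarrow> complex" where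
  "empty_word w = (if w = [] then 1 else 0)"

lemma skew_deriv_empty_word [simp]: "skew_deriv q a empty_word = (\<lambda>w. 0)"
  by (rule ext) (simp add: skew_deriv_def empty_word_def)

lemma skew_deriv_add: "skew_deriv q a (\<lambda>w. f w + h w) = (\<lambda>w. skew_deriv q a f w + skew_deriv q a h w)"
  by (rule ext) (simp add: skew_deriv_def algebra_simps sum.distrib)

lemma skew_deriv_diff: "skew_deriv q a (\<lambda>w. f w - h w) = (\<lambda>w. skew_deriv q a f w - skew_deriv q a h w)"
  by (rule ext) (simp add: skew_deriv_def algebra_simps sum_subtractf)

lemma skew_deriv_scale: "skew_deriv q a (\<lambda>w. c * h w) = (\<lambda>w. c * skew_deriv q a h w)"
  by (rule ext) (simp add: skew_deriv_def sum_distrib_left mult_ac)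

lemma skew_deriv_zero [simp]: "skew_deriv q a (\<lambda>w. 0) = (\<lambda>w. 0)"
  by (rule ext) (simp add: skew_deriv_def)

lemma letter_mult_add: "letter_mult a (\<lambda>w. f w + h w) = (\<lambda>w. letter_mult a f w + letter_mult a h w)"
  by (rule ext) (simp add: letter_mult_def split: list.split)

lemma letter_mult_diff: "letter_mult a (\<lambda>w. f w - h w) = (\<lambda>w. letter_mult a f w - letter_mult a h w)"
  by (rule ext) (simp add: letter_mult_def split: list.split)

lemma letter_mult_scale: "letter_mult a (\<lambda>w. c * h w) = (\<lambda>w. c * letter_mult a h w)"
  by (rule ext) (simp add: letter_mult_def split: list.split)

lemma skew_deriv_minus: "skew_deriv q a (\<lambda>w. - h w) = (\<lambda>w. - skew_deriv q a h w)"
  by (rule ext) (simp add: skew_deriv_def sum_negf)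

lemma letter_mult_minus: "letter_mult a (\<lambda>w. - h w) = (\<lambda>w. - letter_mult a h w)"
  by (rule ext) (simp add: letter_mult_def split: list.split)

lemma letter_mult_zero [simp]: "letter_mult a (\<lambda>w. 0) = (\<lambda>w. 0)"
  by (rule ext) (simp add: letter_mult_def split: list.split)

text \<open>The braided Leibniz rule. A function h stands for the sum of \<open>h w\<close> times
  the word w; \<open>skew_deriv q a\<close> moves each letter a to the front, at the cost
  \<open>q b a\<close> for every letter b that it passes, and deletes it.\<close>

lemma skew_deriv_letter_mult:
  "skew_deriv q a (letter_mult b h) =
     (\<lambda>w. (if a = b then h w else 0) + q b a * letter_mult b (skew_deriv q a h) w)"
proof
  fix w
  show "skew_deriv q a (letter_mult b h) w =
      (if a = b then h w else 0) + q b a * letter_mult b (skew_deriv q a h) w"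
  proof (cases w)
    case Nil
    then show ?thesis by (simp add: skew_deriv_def letter_mult_def)
  next
    case (Cons c w')
    then show ?thesis
      unfolding skew_deriv_def Cons list.size add_Suc_right add_0_right sum.atMost_Suc_shift
      by (simp add: letter_mult_def sum_distrib_left mult_ac skew_deriv_def)
  qed
qed

lemmas skew_deriv_simps =
  skew_deriv_add skew_deriv_diff skew_deriv_scale skew_deriv_minus
  letter_mult_add letter_mult_diff letter_mult_scale letter_mult_minus skew_deriv_letter_mult

section \<open>Powers of imaginary root vectors under chains of derivations\<close>

primrec iter_deriv :: "('i \<Rightarrow> 'i \<Rightarrow> complex) \<Rightarrow> 'i list \<Rightarrow> ('i list \<Rightarrow> complex) \<Rightarrow> 'i list \<Rightarrow> complex" where
  "iter_deriv q [] h = h"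
| "iter_deriv q (a # v) h = iter_deriv q v (skew_deriv q a h)"

lemma iter_deriv_append: "iter_deriv q (u @ v) h = iter_deriv q v (iter_deriv q u h)"
  by (induction u arbitrary: h) auto

lemma iter_deriv_scale: "iter_deriv q v (\<lambda>w. c * h w) = (\<lambda>w. c * iter_deriv q v h w)"
  by (induction v arbitrary: h) (auto simp: skew_deriv_scale)

text \<open>
  Here \<open>u\<close> is left multiplication by a root vector on which the braiding is trivial, and the
  word \<open>v\<close> picks out the derivations that undo one such multiplication.
\<close>

lemma iter_deriv_power:
  assumes step: "\<And>m. iter_deriv q v (u ((u ^^ m) empty_word)) =
      (\<lambda>w. c * (u ^^ m) empty_word w + u (iter_deriv q v ((u ^^ m) empty_word)) w)"
    and scale: "\<And>d h. u (\<lambda>w. d * h w) = (\<lambda>w. d * u h w)"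
    and "v \<noteq> []"
  shows "iter_deriv q (concat (replicate m v)) ((u ^^ m) empty_word) = (\<lambda>w. fact m * c ^ m * empty_word w)"
proof -
  have zero: "iter_deriv q v (\<lambda>w. 0) = (\<lambda>w. 0)" for v
    by (induction v) auto
  have base: "iter_deriv q v empty_word = (\<lambda>w. 0)"
    using \<open>v \<noteq> []\<close> by (cases v) (auto simp: zero)
  have u0: "u (\<lambda>w. 0) = (\<lambda>w. 0)"
    using scale[of 0] by simp
  \<comment> \<open>Leibniz count: each of the \<open>Suc m\<close> factors u contributes the same
    term.\<close>
  have one: "iter_deriv q v ((u ^^ Suc m) empty_word) = (\<lambda>w. of_nat (Suc m) * c * (u ^^ m) empty_word w)" for m
  proof (induction m)
    case 0
    show ?case using step[of 0] by (simp add: base u0)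
  next
    case (Suc m)
    have "iter_deriv q v ((u ^^ Suc (Suc m)) empty_word) =
      (\<lambda>w. c * (u ^^ Suc m) empty_word w + u (iter_deriv q v ((u ^^ Suc m) empty_word)) w)"
      using step[of "Suc m"] by simp
    also have "\<dots> = (\<lambda>w. of_nat (Suc (Suc m)) * c * (u ^^ Suc m) empty_word w)"
      unfolding Suc.IH scale by (simp add: algebra_simps)
    finally show ?case .
  qed
  show ?thesis
  proof (induction m)
    case 0
    then show ?case by simp
  next
    case (Suc m)
    have "iter_deriv q (concat (replicate (Suc m) v)) ((u ^^ Suc m) empty_word) =
      iter_deriv q (concat (replicate m v)) (iter_deriv q v ((u ^^ Suc m) empty_word))"
      by (simp add: iter_deriv_append)
    also have "\<dots> = (\<lambda>w. of_nat (Suc m) * c * (fact m * c ^ m * empty_word w))"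
      unfolding one iter_deriv_scale Suc.IH ..
    finally show ?case by (simp add: mult_ac)
  qed
qed

text \<open>With \<open>q a a = 1\<close> the derivation acts on powers of the letter a as the
  ordinary derivative acts on monomials.\<close>

lemma iter_deriv_rank1:
  assumes "q a a = 1"
  shows "\<exists>h. iter_deriv q (concat (replicate m [a])) h [] \<noteq> 0"
proof -
  have "iter_deriv q (concat (replicate m [a])) ((letter_mult a ^^ m) empty_word) =
     (\<lambda>w. fact m * 1 ^ m * empty_word w)"
    by (rule iter_deriv_power) (auto simp: skew_deriv_simps assms)
  then show ?thesis
    by (metis empty_word_def fact_nonzero mult.right_neutral power_one)
qed

text \<open>
  For affine type \<open>A\<^sub>1\<^sup>(\<^sup>1\<^sup>)\<close> the imaginary root vector is the braided commutator of \<open>x\<^sub>a\<close> and \<open>x\<^sub>b\<close>.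
\<close>

lemma iter_deriv_rank2:
  assumes "a \<noteq> b" and trivial: "q a a * q b b * q a b * q b a = 1" and "q a b * q b a \<noteq> 1"
  shows "\<exists>h. iter_deriv q (concat (replicate m [a, b])) h [] \<noteq> 0"
proof -
  \<comment> \<open>The coefficient \<open>q a b\<close> makes the terms without a derivative of h
    cancel under \<open>skew_deriv q b\<close>, so this derivation kills all powers of u.\<close>
  define u where "u h = (\<lambda>w. letter_mult a (letter_mult b h) w - q a b * letter_mult b (letter_mult a h) w)" for h
  define c where "c = 1 - q a b * q b a"
  have b0: "skew_deriv q b ((u ^^ m) empty_word) = (\<lambda>w. 0)" for m
  proof (induction m)
    case (Suc m)
    have "skew_deriv q b (u h) = (\<lambda>w. q a b * q b b * u (skew_deriv q b h) w)" for h
      using \<open>a \<noteq> b\<close> unfolding u_def by (auto simp: skew_deriv_simps algebra_simps fun_eq_iff)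
    then show ?case using Suc by (simp add: u_def)
  qed simp
  have step: "iter_deriv q [a, b] (u h) = (\<lambda>w. c * h w + u (iter_deriv q [a, b] h) w)"
    if "skew_deriv q b h = (\<lambda>w. 0)" for h
  proof -
    have a: "skew_deriv q a (u h) = (\<lambda>w. c * letter_mult b h w + q a a * q b a * u (skew_deriv q a h) w)"
      using \<open>a \<noteq> b\<close> unfolding u_def c_def by (auto simp: skew_deriv_simps algebra_simps fun_eq_iff)
    \<comment> \<open>The term containing \<open>skew_deriv q b h\<close> alone vanishes by the
      assumption on h; the product of four entries is the self-braiding of u.\<close>
    have "skew_deriv q b (skew_deriv q a (u h)) =
        (\<lambda>w. c * h w + (q a a * q b b * q a b * q b a) * u (skew_deriv q b (skew_deriv q a h)) w)"
      unfolding a using \<open>a \<noteq> b\<close> that by (simp add: u_def skew_deriv_simps algebra_simps)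
    then show ?thesis by (simp add: trivial)
  qed
  have "iter_deriv q (concat (replicate m [a, b])) ((u ^^ m) empty_word) = (\<lambda>w. fact m * c ^ m * empty_word w)"
    by (rule iter_deriv_power)
      (use step b0 in \<open>auto simp: u_def letter_mult_scale fun_eq_iff algebra_simps\<close>)
  moreover have "fact m * c ^ m * empty_word [] \<noteq> 0"
    using assms(3) by (simp add: c_def empty_word_def)
  ultimately show ?thesis by metis
qed

text \<open>
  A triangle with all vertices and all edges labelled \<open>-1\<close>, that is, affine type
  \<open>A\<^sub>2\<^sup>(\<^sup>1\<^sup>)\<close> at \<open>-1\<close>. With \<open>z\<close> the braided commutator of \<open>x\<^sub>a\<close> and \<open>x\<^sub>b\<close>, the imaginary root
  vector is the braided commutator of \<open>z\<close> and \<open>x\<^sub>d\<close>.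
\<close>

lemma iter_deriv_rank3:
  assumes "distinct [a, b, d]"
    and diag: "q a a = -1" "q b b = -1" "q d d = -1"
    and ab: "q a b * q b a = -1" and ad: "q a d * q d a = -1" and bd: "q b d * q d b = -1"
  shows "\<exists>h. iter_deriv q (concat (replicate m [a, d, b])) h [] \<noteq> 0"
proof -
  have ne: "a \<noteq> b" "a \<noteq> d" "b \<noteq> d" "b \<noteq> a" "d \<noteq> a" "d \<noteq> b" using assms(1) by auto
  define z where "z h = (\<lambda>w. letter_mult a (letter_mult b h) w - q a b * letter_mult b (letter_mult a h) w)" for h
  define u where "u h = (\<lambda>w. z (letter_mult d h) w - q a d * q b d * letter_mult d (z h) w)" for h
  \<comment> \<open>One factor 2 is \<open>1 - q a b * q b a\<close>. The other arises because
    \<open>q a d * q d a = -1\<close> makes the contributions of the two orders of b and d add up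
    instead of cancelling.\<close>
  define c where "c = 4 * q b d"
  have z_lin: "z (\<lambda>w. f w + h w) = (\<lambda>w. z f w + z h w)" "z (\<lambda>w. f w - h w) = (\<lambda>w. z f w - z h w)"
    "z (\<lambda>w. r * h w) = (\<lambda>w. r * z h w)" "z (\<lambda>w. 0) = (\<lambda>w. 0)" for f h r
    by (auto simp: z_def letter_mult_add letter_mult_diff letter_mult_scale fun_eq_iff algebra_simps)
  have u_lin: "u (\<lambda>w. r * h w) = (\<lambda>w. r * u h w)" "u (\<lambda>w. 0) = (\<lambda>w. 0)" for h r
    by (auto simp: u_def letter_mult_scale z_lin fun_eq_iff algebra_simps)
  have z_b: "skew_deriv q b (z h) = (\<lambda>w. - q a b * z (skew_deriv q b h) w)" for h
    using ne diag unfolding z_def by (auto simp: skew_deriv_simps algebra_simps fun_eq_iff)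
  have z_d: "skew_deriv q d (z h) = (\<lambda>w. q a d * q b d * z (skew_deriv q d h) w)" for h
    using ne unfolding z_def by (auto simp: skew_deriv_simps algebra_simps fun_eq_iff)
  have z_a: "skew_deriv q a (z h) = (\<lambda>w. 2 * letter_mult b h w - q b a * z (skew_deriv q a h) w)" for h
  proof
    fix w
    have "skew_deriv q a (z h) w = (1 - q a b * q b a) * letter_mult b h w - q b a * z (skew_deriv q a h) w"
      using ne diag unfolding z_def by (simp add: skew_deriv_simps algebra_simps)
    then show "skew_deriv q a (z h) w = 2 * letter_mult b h w - q b a * z (skew_deriv q a h) w"
      by (simp add: ab)
  qed
  have u_b: "skew_deriv q b (u h) = (\<lambda>w. - q a b * q d b * u (skew_deriv q b h) w)" for h
    using ne unfolding u_def by (auto simp: skew_deriv_simps z_b z_lin algebra_simps fun_eq_iff)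
  have u_d: "skew_deriv q d (u h) = (\<lambda>w. - q a d * q b d * u (skew_deriv q d h) w)" for h
    using ne diag unfolding u_def by (auto simp: skew_deriv_simps z_d z_lin algebra_simps fun_eq_iff)
  have u_a: "skew_deriv q a (u h) = (\<lambda>w. 2 * letter_mult b (letter_mult d h) w
       + 2 * q b d * letter_mult d (letter_mult b h) w - q b a * q d a * u (skew_deriv q a h) w)" for h
  proof
    fix w
    have "skew_deriv q a (u h) w = 2 * letter_mult b (letter_mult d h) w
       - 2 * (q a d * q d a) * q b d * letter_mult d (letter_mult b h) w - q b a * q d a * u (skew_deriv q a h) w"
      using ne unfolding u_def by (simp add: skew_deriv_simps z_a z_lin algebra_simps)
    then show "skew_deriv q a (u h) w = 2 * letter_mult b (letter_mult d h) w
       + 2 * q b d * letter_mult d (letter_mult b h) w - q b a * q d a * u (skew_deriv q a h) w"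
      by (simp add: ad)
  qed
  \<comment> \<open>Hence a has to come first in the chain: either of the other derivations would
    kill every power of u.\<close>
  have 0: "skew_deriv q b ((u ^^ m) empty_word) = (\<lambda>w. 0)" "skew_deriv q d ((u ^^ m) empty_word) = (\<lambda>w. 0)" for m
    by (induction m) (simp_all add: u_b u_d u_lin)
  have step: "iter_deriv q [a, d, b] (u h) = (\<lambda>w. c * h w + u (iter_deriv q [a, d, b] h) w)"
    if h0: "skew_deriv q b h = (\<lambda>w. 0)" "skew_deriv q d h = (\<lambda>w. 0)" for h
  proof -
    have "skew_deriv q d (skew_deriv q a (u h)) = (\<lambda>w. 4 * q b d * letter_mult b h w
        + (q a d * q d a) * q b d * q b a * u (skew_deriv q d (skew_deriv q a h)) w)"
      unfolding u_a using ne diag by (simp add: h0 skew_deriv_simps u_d u_lin algebra_simps)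
    note d = this
    \<comment> \<open>The minus sign is the product of the three diagonal entries; together with the
      three edge labels -1 the self-braiding of u becomes 1.\<close>
    have "skew_deriv q b (skew_deriv q d (skew_deriv q a (u h))) = (\<lambda>w. c * h w
        - (q a d * q d a) * (q a b * q b a) * (q b d * q d b) * u (skew_deriv q b (skew_deriv q d (skew_deriv q a h))) w)"
      unfolding d using ne diag by (simp add: h0 skew_deriv_simps u_b u_lin c_def algebra_simps)
    then show ?thesis by (simp add: ab ad bd)
  qed
  have "iter_deriv q (concat (replicate m [a, d, b])) ((u ^^ m) empty_word) = (\<lambda>w. fact m * c ^ m * empty_word w)"
    by (rule iter_deriv_power) (use step 0 u_lin in simp_all)
  moreover have "fact m * c ^ m * empty_word [] \<noteq> 0"
    using bd by (auto simp: c_def empty_word_def)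
  ultimately show ?thesis by metis
qed

section \<open>Inversions and reduced words\<close>

definition inversions :: "nat \<Rightarrow> (nat \<Rightarrow> nat) \<Rightarrow> (nat \<times> nat) set" where
  "inversions n \<sigma> = {(i, j). i < j \<and> j < n \<and> \<sigma> j < \<sigma> i}"

primrec adj_prod :: "nat list \<Rightarrow> nat \<Rightarrow> nat" where
  "adj_prod [] = id"
| "adj_prod (i # is) = Transposition.transpose i (Suc i) \<circ> adj_prod is"

lemma expresses_iff: "expresses n \<sigma> is \<longleftrightarrow> (\<forall>i\<in>set is. Suc i < n) \<and> adj_prod is = \<sigma>"
proof -
  have "foldr (\<lambda>i p. Transposition.transpose i (Suc i) \<circ> p) is id = adj_prod is"
    by (induction "is") auto
  then show ?thesis by (simp add: expresses_def)
qed

lemma finite_inversions [simp]: "finite (inversions n \<sigma>)"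
  by (rule finite_subset[of _ "{..<n} \<times> {..<n}"]) (auto simp: inversions_def)

lemma inversions_id [simp]: "inversions n id = {}" "inversions n (\<lambda>i. i) = {}"
  by (auto simp: inversions_def)

lemma adj_prod_permutes:
  "\<forall>i\<in>set is. Suc i < n \<Longrightarrow> adj_prod is permutes {..<n}"
  by (induction "is") (auto intro!: permutes_compose permutes_swap_id permutes_id)

lemma transpose_Suc_less_iff:
  assumes "a \<noteq> b" "{a, b} \<noteq> {i, Suc i}"
  shows "Transposition.transpose i (Suc i) a < Transposition.transpose i (Suc i) b \<longleftrightarrow> a < b"
  using assms by (auto simp: Transposition.transpose_def)

text \<open>Left multiplication by (i i+1) exchanges the values i and i+1, hence reverses the order
  at the one pair of positions that carries them and at no other pair.\<close>

lemma inversions_adjacent: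
  assumes \<sigma>: "\<sigma> permutes {..<n}" and i: "Suc i < n"
  defines "a \<equiv> inv' \<sigma> i" and "b \<equiv> inv' \<sigma> (Suc i)"
  defines "\<tau> \<equiv> Transposition.transpose i (Suc i) \<circ> \<sigma>"
  shows "a < b \<Longrightarrow> inversions n \<tau> = insert (a, b) (inversions n \<sigma>) \<and> (a, b) \<notin> inversions n \<sigma>"
    and "b < a \<Longrightarrow> inversions n \<tau> = inversions n \<sigma> - {(b, a)} \<and> (b, a) \<in> inversions n \<sigma>"
proof -
  have \<sigma>a: "\<sigma> a = i" and \<sigma>b: "\<sigma> b = Suc i"
    unfolding a_def b_def using permutes_inverses(1)[OF \<sigma>] by auto
  have inj: "\<sigma> x = \<sigma> y \<longleftrightarrow> x = y" for x y
    using permutes_inj[OF \<sigma>] by (auto dest: injD)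
  have ab: "a < n" "b < n"
    using permutes_in_image[OF \<sigma>, of a] permutes_in_image[OF \<sigma>, of b] i by (auto simp: \<sigma>a \<sigma>b)
  have other: "\<tau> y < \<tau> x \<longleftrightarrow> \<sigma> y < \<sigma> x" if "x \<noteq> y" "{x, y} \<noteq> {a, b}" for x y
    unfolding \<tau>_def comp_def
  proof (rule transpose_Suc_less_iff)
    show "{\<sigma> y, \<sigma> x} \<noteq> {i, Suc i}"
      using that \<sigma>a \<sigma>b inj by (metis doubleton_eq_iff)
  qed (use that inj in auto)
  have \<tau>ab: "\<tau> a = Suc i" "\<tau> b = i"
    by (auto simp: \<tau>_def \<sigma>a \<sigma>b)
  have mem: "(x, y) \<in> inversions n \<tau> \<longleftrightarrow> (x, y) \<in> inversions n \<sigma>" if "{x, y} \<noteq> {a, b}" for x y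
    using other[of x y] that by (auto simp: inversions_def)
  show "inversions n \<tau> = insert (a, b) (inversions n \<sigma>) \<and> (a, b) \<notin> inversions n \<sigma>" if "a < b"
  proof -
    have "(a, b) \<in> inversions n \<tau>" "(a, b) \<notin> inversions n \<sigma>"
      "(b, a) \<notin> inversions n \<tau>" "(b, a) \<notin> inversions n \<sigma>"
      using that ab by (auto simp: inversions_def \<tau>ab \<sigma>a \<sigma>b)
    then have "(x, y) \<in> inversions n \<tau> \<longleftrightarrow> (x, y) \<in> insert (a, b) (inversions n \<sigma>)" for x y
      using mem[of x y] that by (cases "{x, y} = {a, b}") (auto simp: doubleton_eq_iff)
    then show ?thesis
      using \<open>(a, b) \<notin> inversions n \<sigma>\<close> by (auto simp: set_eq_iff)
  qed
  show "inversions n \<tau> = inversions n \<sigma> - {(b, a)} \<and> (b, a) \<in> inversions n \<sigma>" if "b < a"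
  proof -
    have "(a, b) \<notin> inversions n \<tau>" "(a, b) \<notin> inversions n \<sigma>"
      "(b, a) \<notin> inversions n \<tau>" "(b, a) \<in> inversions n \<sigma>"
      using that ab by (auto simp: inversions_def \<tau>ab \<sigma>a \<sigma>b)
    then have "(x, y) \<in> inversions n \<tau> \<longleftrightarrow> (x, y) \<in> inversions n \<sigma> - {(b, a)}" for x y
      using mem[of x y] that by (cases "{x, y} = {a, b}") (auto simp: doubleton_eq_iff)
    then show ?thesis
      using \<open>(b, a) \<in> inversions n \<sigma>\<close> by (auto simp: set_eq_iff)
  qed
qed

lemma card_inversions_adjacent_le:
  assumes "\<sigma> permutes {..<n}" "Suc i < n"
  shows "card (inversions n (Transposition.transpose i (Suc i) \<circ> \<sigma>)) \<le> Suc (card (inversions n \<sigma>))"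
proof -
  have "inv' \<sigma> i \<noteq> inv' \<sigma> (Suc i)"
    using permutes_inj[OF permutes_inv[OF assms(1)]] by (metis injD n_not_Suc_n)
  then consider "inv' \<sigma> i < inv' \<sigma> (Suc i)" | "inv' \<sigma> (Suc i) < inv' \<sigma> i" by linarith
  then show ?thesis
  proof cases
    case 1
    then show ?thesis using inversions_adjacent(1)[OF assms] by (simp add: card_insert_if)
  next
    case 2
    then have "card (inversions n (Transposition.transpose i (Suc i) \<circ> \<sigma>)) \<le> card (inversions n \<sigma>)"
      using inversions_adjacent(2)[OF assms] by (intro card_mono) auto
    then show ?thesis by simp
  qed
qed

lemma card_inversions_adj_prod_le:
  "\<forall>i\<in>set is. Suc i < n \<Longrightarrow> card (inversions n (adj_prod is)) \<le> length is"
proof (induction "is")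
  case Nil
  then show ?case by simp
next
  case (Cons i "is")
  then show ?case
    using card_inversions_adjacent_le[OF adj_prod_permutes, of "is" n i] by (auto simp: comp_def)
qed

lemma permutes_lessThan_no_descent:
  assumes \<sigma>: "\<sigma> permutes {..<n::nat}" and mono: "\<And>i. Suc i < n \<Longrightarrow> \<sigma> i \<le> \<sigma> (Suc i)"
  shows "\<sigma> = id"
proof
  have inj: "\<sigma> x = \<sigma> y \<longleftrightarrow> x = y" for x y
    using permutes_inj[OF \<sigma>] by (auto dest: injD)
  have lower: "k \<le> \<sigma> k" if "k < n" for k
    using that
  proof (induction k)
    case (Suc k)
    then have "\<sigma> k \<noteq> \<sigma> (Suc k)" using inj by auto
    then show ?case using Suc mono[of k] by auto
  qed simp
  fix k
  show "\<sigma> k = id k"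
  proof (cases "k < n")
    case False
    then show ?thesis using \<sigma> by (simp add: permutes_def)
  next
    case True
    \<comment> \<open>Downward induction from n: if \<open>k < \<sigma> k\<close>, then
      \<open>\<sigma> k\<close> is already known to be a fixed point, against injectivity.\<close>
    then have "\<forall>m. n - k = m \<longrightarrow> \<sigma> k = k"
    proof (induction "n - k" arbitrary: k rule: less_induct)
      case less
      have "\<sigma> k < n" using permutes_in_image[OF \<sigma>, of k] less.prems by simp
      have "\<sigma> k = k"
      proof (rule ccontr)
        assume "\<sigma> k \<noteq> k"
        then have "k < \<sigma> k" using lower[OF less.prems] by simp
        then have "\<sigma> (\<sigma> k) = \<sigma> k"
          using less.hyps[of "\<sigma> k"] \<open>\<sigma> k < n\<close> by auto
        then show False using inj \<open>\<sigma> k \<noteq> k\<close> by blast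
      qed
      then show ?case by simp
    qed
    then show ?thesis by simp
  qed
qed

text \<open>Bubble sort. As the transpositions act on values, the descents to remove are those of
  the inverse permutation; once there are none, it is increasing and hence the identity.\<close>

lemma exists_word_inversions:
  assumes "\<sigma> permutes {..<n}"
  shows "\<exists>is. expresses n \<sigma> is \<and> length is = card (inversions n \<sigma>)"
  using assms
proof (induction "card (inversions n \<sigma>)" arbitrary: \<sigma> rule: less_induct)
  case less
  show ?case
  proof (cases "\<exists>i. Suc i < n \<and> inv' \<sigma> (Suc i) < inv' \<sigma> i")
    case True
    then obtain i where i: "Suc i < n" "inv' \<sigma> (Suc i) < inv' \<sigma> i" by blast
    let ?t = "Transposition.transpose i (Suc i)"
    note inversions = inversions_adjacent(2)[OF less.prems i]
    have card: "card (inversions n \<sigma>) = Suc (card (inversions n (?t \<circ> \<sigma>)))"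
      using inversions by (metis card_Suc_Diff1 finite_inversions)
    moreover have "?t \<circ> \<sigma> permutes {..<n}"
      using i by (intro permutes_compose[OF less.prems] permutes_swap_id) auto
    ultimately obtain "is" where "is": "expresses n (?t \<circ> \<sigma>) is" "length is = card (inversions n (?t \<circ> \<sigma>))"
      using less.hyps[of "?t \<circ> \<sigma>"] by auto
    then have "expresses n \<sigma> (i # is)" "length (i # is) = card (inversions n \<sigma>)"
      using i card by (auto simp: expresses_iff fun_eq_iff)
    then show ?thesis by blast
  next
    case False
    then have "inv' \<sigma> = id"
      by (intro permutes_lessThan_no_descent[OF permutes_inv[OF less.prems]]) (meson not_le)
    then have "\<sigma> = id"
      using permutes_inv_inv[OF less.prems] by (metis inv_id)
    then have "expresses n \<sigma> []" "inversions n \<sigma> = {}"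
      by (auto simp: expresses_iff inversions_def)
    then show ?thesis by (metis card.empty list.size(3))
  qed
qed

text \<open>The minimal length is squeezed between the bubble sort word and the bound of one new
  inversion per letter. Knowing it makes the arbitrary choice of the word harmless.\<close>

lemma reduced_word:
  assumes "\<sigma> permutes {..<n}"
  shows "expresses n \<sigma> (reduced_word n \<sigma>)"
    and "length (reduced_word n \<sigma>) = card (inversions n \<sigma>)"
proof -
  obtain "is" where "is": "expresses n \<sigma> is" "length is = card (inversions n \<sigma>)"
    using exists_word_inversions[OF assms] by blast
  show 1: "expresses n \<sigma> (reduced_word n \<sigma>)"
    unfolding reduced_word_def using "is"(1) by (rule arg_min_natI)
  have "length (reduced_word n \<sigma>) \<le> length is"
    unfolding reduced_word_def using "is"(1) by (rule arg_min_nat_le)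
  moreover have "card (inversions n \<sigma>) \<le> length (reduced_word n \<sigma>)"
    using 1 card_inversions_adj_prod_le[of "reduced_word n \<sigma>" n] by (auto simp: expresses_iff)
  ultimately show "length (reduced_word n \<sigma>) = card (inversions n \<sigma>)"
    using "is"(2) by simp
qed

section \<open>Braidings that are diagonal on a subspace\<close>

text \<open>
  \<open>x a\<close> are the coordinates in the basis \<open>X\<close> of vectors on whose span the braiding is diagonal.
\<close>

definition diagonal_on ::
  "'b set \<Rightarrow> 'b braiding \<Rightarrow> 'i set \<Rightarrow> ('i \<Rightarrow> 'b \<Rightarrow> complex) \<Rightarrow> ('i \<Rightarrow> 'i \<Rightarrow> complex) \<Rightarrow> bool" where
  "diagonal_on X c I x q \<longleftrightarrow> (\<forall>a\<in>I. \<forall>b\<in>I. \<forall>y z.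
     (\<Sum>t\<in>X. \<Sum>u\<in>X. x a t * x b u * c t u (y, z)) = q a b * (x b y * x a z))"

definition pure_tensor :: "('i \<Rightarrow> 'b \<Rightarrow> complex) \<Rightarrow> nat \<Rightarrow> (nat \<Rightarrow> 'i) \<Rightarrow> 'b list \<Rightarrow> complex" where
  "pure_tensor x n w W = (if length W = n then \<Prod>k<n. x (w k) (W ! k) else 0)"

lemma braid_op_pure_tensor:
  assumes "diagonal_on X c I x q" "Suc i < n" "w ` {..<n} \<subseteq> I"
  shows "braid_op X c i (pure_tensor x n w) =
    (\<lambda>W. q (w i) (w (Suc i)) * pure_tensor x n (w \<circ> Transposition.transpose i (Suc i)) W)"
proof
  fix W
  let ?t = "Transposition.transpose i (Suc i)"
  have I: "w i \<in> I" "w (Suc i) \<in> I" using assms by auto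
  show "braid_op X c i (pure_tensor x n w) W = q (w i) (w (Suc i)) * pure_tensor x n (w \<circ> ?t) W"
  proof (cases "length W = n")
    case False
    then show ?thesis by (simp add: braid_op_def pure_tensor_def)
  next
    case True
    define R where "R = (\<Prod>k\<in>{..<n} - {i, Suc i}. x (w k) (W ! k))"
    have split: "(\<Prod>k<n. f k) = f i * f (Suc i) * (\<Prod>k\<in>{..<n} - {i, Suc i}. f k)" for f :: "nat \<Rightarrow> complex"
    proof -
      have "{..<n} = {i, Suc i} \<union> ({..<n} - {i, Suc i})" using assms(2) by auto
      then have "(\<Prod>k<n. f k) = (\<Prod>k\<in>{i, Suc i}. f k) * (\<Prod>k\<in>{..<n} - {i, Suc i}. f k)"
        by (metis Diff_disjoint finite.emptyI finite_Diff finite_insert finite_lessThan prod.union_disjoint)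
      then show ?thesis by simp
    qed
    have 1: "pure_tensor x n w (W[i := t, Suc i := u]) = x (w i) t * x (w (Suc i)) u * R" for t u
    proof -
      have "(\<Prod>k\<in>{..<n} - {i, Suc i}. x (w k) (W[i := t, Suc i := u] ! k)) = R"
        unfolding R_def by (rule prod.cong) auto
      then show ?thesis
        using True assms(2) by (simp add: pure_tensor_def split)
    qed
    have 2: "pure_tensor x n (w \<circ> ?t) W = x (w (Suc i)) (W ! i) * x (w i) (W ! Suc i) * R"
    proof -
      have "(\<Prod>k\<in>{..<n} - {i, Suc i}. x ((w \<circ> ?t) k) (W ! k)) = R"
        unfolding R_def by (rule prod.cong) auto
      then show ?thesis
        using True by (simp add: pure_tensor_def split)
    qed
    have "braid_op X c i (pure_tensor x n w) W =
      (\<Sum>t\<in>X. \<Sum>u\<in>X. x (w i) t * x (w (Suc i)) u * c t u (W ! i, W ! Suc i)) * R"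
      unfolding braid_op_def 1 sum_distrib_right by (simp add: mult_ac)
    also have "\<dots> = q (w i) (w (Suc i)) * (x (w (Suc i)) (W ! i) * x (w i) (W ! Suc i)) * R"
      using assms(1) I by (simp add: diagonal_on_def)
    finally show ?thesis by (simp add: 2 mult_ac)
  qed
qed

lemma braid_op_lincomb:
  "braid_op X c i (\<lambda>W. \<Sum>a\<in>A. r a * f a W) = (\<lambda>W. \<Sum>a\<in>A. r a * braid_op X c i (f a) W)"
proof
  fix W
  have "braid_op X c i (\<lambda>W. \<Sum>a\<in>A. r a * f a W) W =
    (\<Sum>t\<in>X. \<Sum>u\<in>X. \<Sum>a\<in>A. r a * (f a (W[i := t, Suc i := u]) * c t u (W ! i, W ! Suc i)))"
    by (simp add: braid_op_def sum_distrib_right mult.assoc)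
  also have "\<dots> = (\<Sum>a\<in>A. \<Sum>t\<in>X. \<Sum>u\<in>X. r a * (f a (W[i := t, Suc i := u]) * c t u (W ! i, W ! Suc i)))"
    by (subst sum.swap[of _ A X], subst sum.swap[of _ A X]) rule
  finally show "braid_op X c i (\<lambda>W. \<Sum>a\<in>A. r a * f a W) W = (\<Sum>a\<in>A. r a * braid_op X c i (f a) W)"
    by (simp add: braid_op_def sum_distrib_left)
qed

lemma braid_op_scale: "braid_op X c i (\<lambda>W. r * f W) = (\<lambda>W. r * braid_op X c i f W)"
  using braid_op_lincomb[of X c i "\<lambda>_. r" "\<lambda>_. f" "{()}"] by simp

lemma braid_lift_lincomb:
  "braid_lift X c n \<sigma> (\<lambda>W. \<Sum>a\<in>A. r a * f a W) = (\<lambda>W. \<Sum>a\<in>A. r a * braid_lift X c n \<sigma> (f a) W)"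
proof -
  have "foldr (\<lambda>i F. braid_op X c i \<circ> F) is id (\<lambda>W. \<Sum>a\<in>A. r a * f a W) =
    (\<lambda>W. \<Sum>a\<in>A. r a * foldr (\<lambda>i F. braid_op X c i \<circ> F) is id (f a) W)" for "is"
    by (induction "is") (simp_all add: braid_op_lincomb)
  then show ?thesis by (simp add: braid_lift_def)
qed

text \<open>
  In a word of minimal length no two strands cross twice, so the lift collects \<open>q\<close> exactly once
  for every inversion.
\<close>

lemma braid_lift_pure_tensor:
  assumes diag: "diagonal_on X c I x q" and w: "w ` {..<n} \<subseteq> I" and \<sigma>: "\<sigma> permutes {..<n}"
  shows "braid_lift X c n \<sigma> (pure_tensor x n w) =
    (\<lambda>W. (\<Prod>(i, j)\<in>inversions n \<sigma>. q (w i) (w j)) * pure_tensor x n (w \<circ> inv' \<sigma>) W)"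
proof -
  let ?lift = "\<lambda>is. foldr (\<lambda>i F. braid_op X c i \<circ> F) is id"
  have "?lift is (pure_tensor x n w) =
      (\<lambda>W. (\<Prod>(i, j)\<in>inversions n (adj_prod is). q (w i) (w j)) * pure_tensor x n (w \<circ> inv' (adj_prod is)) W)"
    if "\<forall>i\<in>set is. Suc i < n" "length is = card (inversions n (adj_prod is))" for "is"
    using that
  proof (induction "is")
    case Nil
    show ?case by simp
  next
    case (Cons i "is")
    let ?\<sigma> = "adj_prod is" and ?t = "Transposition.transpose i (Suc i)"
    have i: "Suc i < n" and "is": "\<forall>i\<in>set is. Suc i < n" using Cons.prems by auto
    note perm = adj_prod_permutes[OF "is"]
    have le: "card (inversions n ?\<sigma>) \<le> length is"
      by (rule card_inversions_adj_prod_le[OF "is"])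
    have card: "card (inversions n (?t \<circ> ?\<sigma>)) = Suc (length is)" using Cons.prems by (simp add: comp_def)
    \<comment> \<open>A letter that removed an inversion would leave fewer inversions than letters.
      So each letter adds one, and the rest of the word is again of minimal length.\<close>
    have "\<not> inv' ?\<sigma> (Suc i) < inv' ?\<sigma> i"
    proof
      assume "inv' ?\<sigma> (Suc i) < inv' ?\<sigma> i"
      then have "card (inversions n (?t \<circ> ?\<sigma>)) \<le> card (inversions n ?\<sigma>)"
        using inversions_adjacent(2)[OF perm i] by (intro card_mono) auto
      then show False using le card by simp
    qed
    moreover have "inv' ?\<sigma> i \<noteq> inv' ?\<sigma> (Suc i)"
      using permutes_inj[OF permutes_inv[OF perm]] by (metis injD n_not_Suc_n)
    ultimately have "inv' ?\<sigma> i < inv' ?\<sigma> (Suc i)" by simp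
    note inversions = inversions_adjacent(1)[OF perm i this]
    have "length is = card (inversions n ?\<sigma>)"
      using card inversions by (simp add: card_insert_if)
    note IH = Cons.IH[OF "is" this]
    have "inv' ?\<sigma> permutes {..<n}" by (rule permutes_inv[OF perm])
    then have "(w \<circ> inv' ?\<sigma>) ` {..<n} \<subseteq> I"
      using w permutes_in_image[of "inv' ?\<sigma>" "{..<n}"] by (auto simp: image_subset_iff)
    note op = braid_op_pure_tensor[OF diag i this]
    have inv: "inv' (?t \<circ> ?\<sigma>) = inv' ?\<sigma> \<circ> ?t"
      using permutes_bij[OF perm] by (subst o_inv_distrib) (auto simp: inv_transpose_eq)
    have "?lift (i # is) (pure_tensor x n w) = braid_op X c i (?lift is (pure_tensor x n w))"
      by simp
    also have "\<dots> = (\<lambda>W. (\<Prod>(i, j)\<in>inversions n ?\<sigma>. q (w i) (w j)) *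
        (q (w (inv' ?\<sigma> i)) (w (inv' ?\<sigma> (Suc i))) * pure_tensor x n (w \<circ> inv' ?\<sigma> \<circ> ?t) W))"
      unfolding IH braid_op_scale op by (simp only: comp_apply)
    also have "\<dots> = (\<lambda>W. (\<Prod>(i, j)\<in>inversions n (?t \<circ> ?\<sigma>). q (w i) (w j)) *
        pure_tensor x n (w \<circ> inv' (?t \<circ> ?\<sigma>)) W)"
      using inversions by (simp add: inv comp_assoc mult_ac)
    finally show ?case by (simp only: adj_prod.simps)
  qed
  then show ?thesis
    using reduced_word[OF \<sigma>] by (auto simp: braid_lift_def expresses_iff)
qed

section \<open>Coefficients of the quantum symmetrizer\<close>

text \<open>The inversion product of an arrangement of positions. Recursion over a list allows
  arrangements of any finite set of positions, which arise once the smallest ones have been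
  removed.\<close>

primrec list_weight :: "('i \<Rightarrow> 'i \<Rightarrow> complex) \<Rightarrow> (nat \<Rightarrow> 'i) \<Rightarrow> nat list \<Rightarrow> complex" where
  "list_weight q v [] = 1"
| "list_weight q v (i # is) = (\<Prod>j\<leftarrow>filter (\<lambda>j. j < i) is. q (v i) (v j)) * list_weight q v is"

text \<open>Being smaller than all other entries, m forms inversions exactly with those in front of
  it; this is the prefix product in \<open>skew_deriv\<close>.\<close>

lemma list_weight_insert:
  assumes "\<forall>j\<in>set (is @ js). m < j"
  shows "list_weight q v (is @ m # js) = (\<Prod>j\<leftarrow>is. q (v j) (v m)) * list_weight q v (is @ js)"
  using assms
proof (induction "is")
  case Nil
  then have "filter (\<lambda>j. j < m) js = []" by (auto simp: filter_empty_conv)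
  then show ?case by simp
qed (auto simp: mult_ac)

lemma list_weight_map_upt:
  "list_weight q v (map \<sigma> [k..<n]) =
     (\<Prod>(i, j)\<in>{(i, j). k \<le> i \<and> i < j \<and> j < n \<and> \<sigma> j < \<sigma> i}. q (v (\<sigma> i)) (v (\<sigma> j)))"
proof (induction "n - k" arbitrary: k)
  case 0
  then have empty: "{(i, j). k \<le> i \<and> i < j \<and> j < n \<and> \<sigma> j < \<sigma> i} = {}" by auto
  show ?case unfolding empty using 0 by simp
next
  case (Suc d)
  let ?S = "\<lambda>k. {(i, j). k \<le> i \<and> i < j \<and> j < n \<and> \<sigma> j < \<sigma> i}"
  let ?J = "{j. k < j \<and> j < n \<and> \<sigma> j < \<sigma> k}"
  have fin: "finite (?S m)" for m
    by (rule finite_subset[of _ "{..<n} \<times> {..<n}"]) auto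
  have S: "?S k = Pair k ` ?J \<union> ?S (Suc k)" by (auto simp: Suc_le_eq le_less)
  have "(\<Prod>(i, j)\<in>?S k. q (v (\<sigma> i)) (v (\<sigma> j))) =
    (\<Prod>(i, j)\<in>Pair k ` ?J. q (v (\<sigma> i)) (v (\<sigma> j))) * (\<Prod>(i, j)\<in>?S (Suc k). q (v (\<sigma> i)) (v (\<sigma> j)))"
    unfolding S by (rule prod.union_disjoint) (auto intro: fin)
  also have "(\<Prod>(i, j)\<in>Pair k ` ?J. q (v (\<sigma> i)) (v (\<sigma> j))) = (\<Prod>j\<in>?J. q (v (\<sigma> k)) (v (\<sigma> j)))"
    by (subst prod.reindex) (auto simp: inj_on_def)
  also have "?J = set (filter (\<lambda>j. \<sigma> j < \<sigma> k) [Suc k..<n])" by auto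
  also have "(\<Prod>j\<in>set (filter (\<lambda>j. \<sigma> j < \<sigma> k) [Suc k..<n]). q (v (\<sigma> k)) (v (\<sigma> j))) =
     (\<Prod>j\<leftarrow>filter (\<lambda>j. j < \<sigma> k) (map \<sigma> [Suc k..<n]). q (v (\<sigma> k)) (v j))"
    by (subst prod.distinct_set_conv_list) (auto simp: filter_map comp_def)
  finally show ?case
    using Suc.hyps(2) Suc.hyps(1)[of "Suc k"] by (simp add: upt_conv_Cons)
qed

text \<open>An arrangement of \<open>insert m B\<close> is an arrangement of B together with a slot
  for m; the inverse map measures the prefix before m and deletes m.\<close>

lemma bij_betw_insert_at:
  assumes "finite B" "m \<notin> B"
  shows "bij_betw (\<lambda>(k, is). take k is @ m # drop k is)
    ({..card B} \<times> permutations_of_set B) (permutations_of_set (insert m B))"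
proof (rule bij_betw_byWitness[where f' = "\<lambda>is. (length (takeWhile (\<lambda>j. j \<noteq> m) is), remove1 m is)"])
  have len: "length is = card B" if "is \<in> permutations_of_set B" for "is"
    using that by (rule length_finite_permutations_of_set)
  have notin: "m \<notin> set is" if "is \<in> permutations_of_set B" for "is"
    using that assms by (auto dest: permutations_of_setD)
  have notin': "m \<notin> set (take k is)" if "is \<in> permutations_of_set B" for "is" k
    using notin[OF that] by (meson in_set_takeD)
  show "\<forall>p\<in>{..card B} \<times> permutations_of_set B.
    (length (takeWhile (\<lambda>j. j \<noteq> m) ((\<lambda>(k, is). take k is @ m # drop k is) p)),
     remove1 m ((\<lambda>(k, is). take k is @ m # drop k is) p)) = p"
  proof (clarsimp simp: len, intro conjI)
    fix k "is"
    assume k: "k \<le> card B" and "is": "is \<in> permutations_of_set B"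
    have "takeWhile (\<lambda>j. j \<noteq> m) (take k is @ m # drop k is) = take k is"
      using notin'[OF "is"] by (subst takeWhile_append2) auto
    then show "length (takeWhile (\<lambda>j. j \<noteq> m) (take k is @ m # drop k is)) = k"
      using k len[OF "is"] by simp
    show "remove1 m (take k is @ m # drop k is) = is"
      using notin'[OF "is"] by (simp add: remove1_append)
  qed
  have *: "\<exists>ys zs. is = ys @ m # zs \<and> ys @ zs \<in> permutations_of_set B \<and> m \<notin> set ys"
    if "is \<in> permutations_of_set (insert m B)" for "is"
  proof -
    have "m \<in> set is" and d: "distinct is" "set is = insert m B"
      using that by (auto simp: permutations_of_set_def)
    then obtain ys zs where yz: "is = ys @ m # zs" "m \<notin> set ys"
      using split_list_first by metis
    then have "ys @ zs \<in> permutations_of_set B"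
      using d assms by (auto simp: permutations_of_set_def)
    then show ?thesis using yz by blast
  qed
  have 2: "takeWhile (\<lambda>j. j \<noteq> m) (ys @ m # zs) = ys" "remove1 m (ys @ m # zs) = ys @ zs"
    if "m \<notin> set ys" for ys zs
    using that by (auto simp: remove1_append takeWhile_tail)
  show "\<forall>is\<in>permutations_of_set (insert m B).
    (\<lambda>(k, is). take k is @ m # drop k is) (length (takeWhile (\<lambda>j. j \<noteq> m) is), remove1 m is) = is"
    using * 2 by fastforce
  show "(\<lambda>(k, is). take k is @ m # drop k is) ` ({..card B} \<times> permutations_of_set B)
    \<subseteq> permutations_of_set (insert m B)"
  proof (clarsimp)
    fix k "is"
    assume "is \<in> permutations_of_set B"
    then show "take k is @ m # drop k is \<in> permutations_of_set (insert m B)"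
      using notin[of "is"] distinct_append[of "take k is" "drop k is"] set_append[of "take k is" "drop k is"]
      by (auto simp: permutations_of_set_def dest: in_set_takeD in_set_dropD)
  qed
  show "(\<lambda>is. (length (takeWhile (\<lambda>j. j \<noteq> m) is), remove1 m is)) ` permutations_of_set (insert m B)
    \<subseteq> {..card B} \<times> permutations_of_set B"
  proof (clarify, intro conjI SigmaI)
    fix "is" assume "is \<in> permutations_of_set (insert m B)"
    from *[OF this] obtain ys zs where yz: "is = ys @ m # zs" "ys @ zs \<in> permutations_of_set B" "m \<notin> set ys"
      by blast
    show "length (takeWhile (\<lambda>j. j \<noteq> m) is) \<in> {..card B}"
      using yz 2 len[OF yz(2)] by simp
    show "remove1 m is \<in> permutations_of_set B"
      using yz 2 by simp
  qed
qed

text \<open>Removing the smallest position from an arrangement is one skew derivation.\<close>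

lemma sum_permutations_iter_deriv:
  assumes "finite A"
  shows "(\<Sum>is\<in>permutations_of_set A. h (map v is) * list_weight q v is) =
    iter_deriv q (map v (sorted_list_of_set A)) h []"
  using assms
proof (induction "card A" arbitrary: A h)
  case 0
  then show ?case by simp
next
  case (Suc d)
  define m where "m = Min A"
  define B where "B = A - {m}"
  have "A \<noteq> {}" using Suc by auto
  then have "m \<in> A" using Suc.prems by (simp add: m_def)
  then have A: "A = insert m B" "m \<notin> B" "finite B" using Suc.prems by (auto simp: B_def)
  have sorted: "sorted_list_of_set A = m # sorted_list_of_set B"
    using Suc.prems \<open>A \<noteq> {}\<close> by (simp add: sorted_list_of_set_nonempty m_def B_def)
  have less: "\<forall>j\<in>B. m < j"
    using Suc.prems by (auto simp: m_def B_def order.strict_iff_order)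
  let ?f = "\<lambda>is. h (map v is) * list_weight q v is"
  have "(\<Sum>is\<in>permutations_of_set A. ?f is) =
    (\<Sum>(k, is)\<in>{..card B} \<times> permutations_of_set B. ?f (take k is @ m # drop k is))"
    unfolding A(1) by (subst sum.reindex_bij_betw[OF bij_betw_insert_at[OF A(3,2)], symmetric])
      (simp add: case_prod_unfold)
  also have "\<dots> = (\<Sum>is\<in>permutations_of_set B. \<Sum>k\<le>card B. ?f (take k is @ m # drop k is))"
    by (subst sum.swap, subst sum.cartesian_product) simp
  \<comment> \<open>The sum over the slots k for m is the sum that defines
    \<open>skew_deriv q (v m) h\<close>, evaluated at the word of the remaining positions.\<close>
  also have "\<dots> = (\<Sum>is\<in>permutations_of_set B. skew_deriv q (v m) h (map v is) * list_weight q v is)"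
  proof (rule sum.cong[OF refl])
    fix "is" assume "is": "is \<in> permutations_of_set B"
    then have len: "length is = card B" and set: "set is = B"
      by (auto simp: length_finite_permutations_of_set dest: permutations_of_setD)
    have "list_weight q v (take k is @ m # drop k is) = (\<Prod>j\<leftarrow>take k is. q (v j) (v m)) * list_weight q v is" for k
      using less set by (subst list_weight_insert) (auto dest: in_set_takeD in_set_dropD)
    then show "(\<Sum>k\<le>card B. ?f (take k is @ m # drop k is)) = skew_deriv q (v m) h (map v is) * list_weight q v is"
      by (simp add: skew_deriv_def len sum_distrib_left take_map drop_map mult_ac comp_def)
  qed
  also have "\<dots> = iter_deriv q (map v (sorted_list_of_set A)) h []"
    unfolding sorted using Suc.hyps(1)[of B] Suc.hyps(2) A by simp
  finally show ?case .
qed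

lemma bij_betw_permutes_permutations_of_set:
  "bij_betw (\<lambda>\<sigma>. map \<sigma> [0..<n]) {\<sigma>. \<sigma> permutes {..<n}} (permutations_of_set {..<n})"
proof -
  have inj: "inj_on (\<lambda>\<sigma>. map \<sigma> [0..<n]) {\<sigma>. \<sigma> permutes {..<n}}"
  proof (rule inj_onI, rule ext)
    fix \<sigma> \<tau> k
    assume "\<sigma> \<in> {\<sigma>. \<sigma> permutes {..<n}}" "\<tau> \<in> {\<sigma>. \<sigma> permutes {..<n}}" "map \<sigma> [0..<n] = map \<tau> [0..<n]"
    then show "\<sigma> k = \<tau> k" by (cases "k < n") (auto simp: permutes_def)
  qed
  have "(\<lambda>\<sigma>. map \<sigma> [0..<n]) ` {\<sigma>. \<sigma> permutes {..<n}} = permutations_of_set {..<n}"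
  proof (rule card_subset_eq)
    show "(\<lambda>\<sigma>. map \<sigma> [0..<n]) ` {\<sigma>. \<sigma> permutes {..<n}} \<subseteq> permutations_of_set {..<n}"
      using permutes_image
      by (fastforce simp: permutations_of_set_def distinct_map lessThan_atLeast0 permutes_inj_on)
    show "card ((\<lambda>\<sigma>. map \<sigma> [0..<n]) ` {\<sigma>. \<sigma> permutes {..<n}}) = card (permutations_of_set {..<n})"
      by (simp add: card_image[OF inj] card_permutations)
  qed simp
  with inj show ?thesis by (simp add: bij_betw_def)
qed

text \<open>The degree n part of the algebra map from the free algebra on I that sends the letter a
  to the vector \<open>x a\<close>, in coordinates.\<close>

definition word_tensor :: "'i set \<Rightarrow> ('i \<Rightarrow> 'b \<Rightarrow> complex) \<Rightarrow> nat \<Rightarrow> ('i list \<Rightarrow> complex) \<Rightarrow> 'b list \<Rightarrow> complex" where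
  "word_tensor I x n h = (\<lambda>W. \<Sum>w\<in>{w. set w \<subseteq> I \<and> length w = n}. h w * pure_tensor x n ((!) w) W)"

text \<open>At the dual word \<open>map \<xi> v\<close> the lift of \<sigma> sees a single word of
  the input, namely v rearranged by \<sigma>, and weights it with its inversion product. Summing
  over \<sigma> gives the weighted sum over arrangements.\<close>

lemma quantum_symmetrizer_word_tensor:
  assumes diag: "diagonal_on X c I x q" and "finite I"
    and dual: "\<And>a b. a \<in> I \<Longrightarrow> b \<in> I \<Longrightarrow> x a (\<xi> b) = (if a = b then 1 else 0)"
    and v: "set v \<subseteq> I"
  shows "quantum_symmetrizer X c (length v) (word_tensor I x (length v) h) (map \<xi> v) = iter_deriv q v h []"
proof -
  define n where "n = length v"
  let ?W = "{w. set w \<subseteq> I \<and> length w = n}"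
  have finW: "finite ?W" by (rule finite_lists_length_eq[OF \<open>finite I\<close>])
  have "braid_lift X c n \<sigma> (word_tensor I x n h) (map \<xi> v) =
      h (map ((!) v) (map \<sigma> [0..<n])) * list_weight q ((!) v) (map \<sigma> [0..<n])"
    if \<sigma>: "\<sigma> permutes {..<n}" for \<sigma>
  proof -
    let ?w0 = "map (\<lambda>i. v ! \<sigma> i) [0..<n]"
    have \<sigma>n: "\<sigma> i < n" if "i < n" for i
      using permutes_in_image[OF \<sigma>, of i] that by simp
    then have w0: "?w0 \<in> ?W"
      using v by (auto simp: n_def subset_iff)
    have eq: "braid_lift X c n \<sigma> (pure_tensor x n ((!) w)) (map \<xi> v) =
        (if w = ?w0 then \<Prod>(i, j)\<in>inversions n \<sigma>. q (v ! \<sigma> i) (v ! \<sigma> j) else 0)" if w: "w \<in> ?W" for w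
    proof -
      have sub: "(!) w ` {..<n} \<subseteq> I" using w by auto
      have "pure_tensor x n ((!) w \<circ> inv' \<sigma>) (map \<xi> v) = (\<Prod>k<n. x (w ! inv' \<sigma> k) (\<xi> (v ! k)))"
        by (simp add: pure_tensor_def n_def)
      also have "\<dots> = (\<Prod>k<n. x (w ! k) (\<xi> (v ! \<sigma> k)))"
        using permutes_inverses(2)[OF \<sigma>]
        by (subst prod.permute[OF \<sigma>]) (simp add: comp_def)
      also have "\<dots> = (\<Prod>k<n. if w ! k = v ! \<sigma> k then 1 else 0)"
        using w v \<sigma>n by (intro prod.cong[OF refl] dual) (auto simp: n_def)
      also have "\<dots> = (if \<forall>k<n. w ! k = v ! \<sigma> k then 1 else 0)"
        by (auto intro!: prod_zero)
      also have "(\<forall>k<n. w ! k = v ! \<sigma> k) \<longleftrightarrow> w = ?w0"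
        using w by (auto simp: list_eq_iff_nth_eq)
      finally have coeff: "pure_tensor x n ((!) w \<circ> inv' \<sigma>) (map \<xi> v) = (if w = ?w0 then 1 else 0)" .
      have "braid_lift X c n \<sigma> (pure_tensor x n ((!) w)) (map \<xi> v) =
        (\<Prod>(i, j)\<in>inversions n \<sigma>. q (w ! i) (w ! j)) * (if w = ?w0 then 1 else 0)"
        by (simp only: braid_lift_pure_tensor[OF diag sub \<sigma>] coeff)
      moreover have "(\<Prod>(i, j)\<in>inversions n \<sigma>. q (?w0 ! i) (?w0 ! j)) =
         (\<Prod>(i, j)\<in>inversions n \<sigma>. q (v ! \<sigma> i) (v ! \<sigma> j))"
        by (rule prod.cong) (auto simp: inversions_def)
      ultimately show ?thesis by simp
    qed
    have "braid_lift X c n \<sigma> (word_tensor I x n h) (map \<xi> v) =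
      (\<Sum>w\<in>?W. if w = ?w0 then h w * (\<Prod>(i, j)\<in>inversions n \<sigma>. q (v ! \<sigma> i) (v ! \<sigma> j)) else 0)"
      unfolding word_tensor_def braid_lift_lincomb by (rule sum.cong[OF refl]) (simp add: eq)
    also have "\<dots> = h ?w0 * (\<Prod>(i, j)\<in>inversions n \<sigma>. q (v ! \<sigma> i) (v ! \<sigma> j))"
      using finW w0 by simp
    also have "(\<Prod>(i, j)\<in>inversions n \<sigma>. q (v ! \<sigma> i) (v ! \<sigma> j)) = list_weight q ((!) v) (map \<sigma> [0..<n])"
      unfolding list_weight_map_upt by (simp add: inversions_def)
    finally show ?thesis by (simp add: comp_def)
  qed
  then have "quantum_symmetrizer X c n (word_tensor I x n h) (map \<xi> v) =
    (\<Sum>\<sigma> | \<sigma> permutes {..<n}. h (map ((!) v) (map \<sigma> [0..<n])) * list_weight q ((!) v) (map \<sigma> [0..<n]))"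
    unfolding quantum_symmetrizer_def by (intro sum.cong) auto
  also have "\<dots> = (\<Sum>is\<in>permutations_of_set {..<n}. h (map ((!) v) is) * list_weight q ((!) v) is)"
    using bij_betw_permutes_permutations_of_set by (rule sum.reindex_bij_betw)
  also have "\<dots> = iter_deriv q v h []"
    by (subst sum_permutations_iter_deriv) (simp_all add: lessThan_atLeast0 n_def map_nth)
  finally show ?thesis by (simp add: n_def)
qed

section \<open>A criterion for infinite dimension\<close>

text \<open>A finite spanning family has bounded degree. Above the bound, a homogeneous f would
  equal the degree n part of a member of the ideal, which the symmetrizer kills.\<close>

lemma not_nichols_finite_dim:
  fixes X :: "'b set"
  assumes "finite X" and high: "\<And>N. \<exists>n\<ge>N. \<exists>f\<in>carrier (tensor_algebra X).
      homogeneous_part n f = f \<and> quantum_symmetrizer X c n f \<noteq> (\<lambda>w. 0)"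
  shows "\<not> nichols_finite_dim X c"
proof
  assume "nichols_finite_dim X c"
  then obtain F where F: "finite F" "F \<subseteq> carrier (tensor_algebra X)"
    and span: "\<And>u. u \<in> carrier (nichols_algebra X c) \<Longrightarrow> \<exists>a :: ('b list \<Rightarrow> complex) \<Rightarrow> complex.
       u = nichols_ideal X c +>\<^bsub>tensor_algebra X\<^esub> (\<lambda>w. \<Sum>f\<in>F. a f * f w)"
    unfolding nichols_finite_dim_def by blast
  have "finite (length ` (\<Union>f\<in>F. {w. f w \<noteq> 0}))"
    using F by (auto simp: tensor_algebra_def)
  then obtain N where "\<forall>l\<in>length ` (\<Union>f\<in>F. {w. f w \<noteq> 0}). l < N"
    using finite_nat_set_iff_bounded by blast
  then have vanish: "g w = 0" if "g \<in> F" "length w \<ge> N" for g w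
    using that by force
  obtain n f where n: "n \<ge> N" and f: "f \<in> carrier (tensor_algebra X)" "homogeneous_part n f = f"
    and ne: "quantum_symmetrizer X c n f \<noteq> (\<lambda>w. 0)"
    using high[of N] by blast
  have "nichols_ideal X c +>\<^bsub>tensor_algebra X\<^esub> f \<in> carrier (nichols_algebra X c)"
    using f by (auto simp: nichols_algebra_def FactRing_def A_RCOSETS_def')
  from span[OF this] obtain a :: "('b list \<Rightarrow> complex) \<Rightarrow> complex" where
    a: "nichols_ideal X c +>\<^bsub>tensor_algebra X\<^esub> f =
      nichols_ideal X c +>\<^bsub>tensor_algebra X\<^esub> (\<lambda>w. \<Sum>g\<in>F. a g * g w)" ..
  have "braid_lift X c m \<sigma> (\<lambda>w. 0) = (\<lambda>w. 0)" for m \<sigma>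
    using braid_lift_lincomb[of X c m \<sigma> "\<lambda>_. 0" "\<lambda>_ _. 0" "{}"] by simp
  moreover have "homogeneous_part m (\<lambda>w. 0) = (\<lambda>w :: 'b list. 0)" for m
    by (auto simp: homogeneous_part_def)
  ultimately have "(\<lambda>w. 0) \<in> nichols_ideal X c"
    by (simp add: nichols_ideal_def tensor_algebra_def quantum_symmetrizer_def)
  then have "f \<in> nichols_ideal X c +>\<^bsub>tensor_algebra X\<^esub> f"
    by (force simp: a_r_coset_def' tensor_algebra_def)
  then obtain i where i: "i \<in> nichols_ideal X c" "f = (\<lambda>w. i w + (\<Sum>g\<in>F. a g * g w))"
    unfolding a by (auto simp: a_r_coset_def' tensor_algebra_def)
  have "homogeneous_part n i w = f w" for w
  proof (cases "length w = n")
    case True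
    have "(\<Sum>g\<in>F. a g * g w) = 0"
      using True n vanish by (intro sum.neutral) auto
    then show ?thesis using i(2) True by (auto simp: homogeneous_part_def fun_eq_iff)
  next
    case False
    then show ?thesis using f(2) by (metis homogeneous_part_def)
  qed
  then have "homogeneous_part n i = f" by blast
  then show False using i(1) ne by (auto simp: nichols_ideal_def)
qed

text \<open>Repeating v gives words of unbounded length, and \<open>dual\<close> turns each nonzero
  chain of derivations into a nonzero coordinate of a symmetrized tensor.\<close>

lemma not_nichols_finite_dim_diagonal:
  assumes "finite X" and diag: "diagonal_on X c I x q" and "finite I"
    and supp: "\<And>a t. a \<in> I \<Longrightarrow> x a t \<noteq> 0 \<Longrightarrow> t \<in> X"
    and dual: "\<And>a b. a \<in> I \<Longrightarrow> b \<in> I \<Longrightarrow> x a (\<xi> b) = (if a = b then 1 else 0)"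
    and "set v \<subseteq> I" "v \<noteq> []"
    and high: "\<And>m. \<exists>h. iter_deriv q (concat (replicate m v)) h [] \<noteq> 0"
  shows "\<not> nichols_finite_dim X c"
proof (rule not_nichols_finite_dim[OF \<open>finite X\<close>])
  fix N
  define u where "u = concat (replicate N v)"
  have "length u = N * length v" by (simp add: u_def length_concat sum_list_replicate)
  moreover have "1 \<le> length v" using \<open>v \<noteq> []\<close> by (cases v) auto
  ultimately have N: "N \<le> length u" by (metis mult.right_neutral mult_le_mono2)
  have u: "set u \<subseteq> I" using \<open>set v \<subseteq> I\<close> by (auto simp: u_def)
  obtain h where h: "iter_deriv q u h [] \<noteq> 0" using high[of N] by (auto simp: u_def)
  let ?f = "word_tensor I x (length u) h"
  have zero: "pure_tensor x (length u) ((!) w) W = 0"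
    if w: "set w \<subseteq> I" "length w = length u" and W: "\<not> (W \<in> lists X \<and> length W = length u)" for w W
  proof (cases "length W = length u")
    case True
    then obtain k where "k < length u" "W ! k \<notin> X"
      using W by (metis in_listsI in_set_conv_nth)
    moreover have "w ! k \<in> I" using w \<open>k < length u\<close> by auto
    ultimately have "x (w ! k) (W ! k) = 0"
      using supp[of "w ! k" "W ! k"] by blast
    then show ?thesis using \<open>k < length u\<close> by (auto simp: pure_tensor_def intro!: prod_zero)
  qed (simp add: pure_tensor_def)
  then have zero: "?f W = 0" if "\<not> (W \<in> lists X \<and> length W = length u)" for W
    using that by (auto simp: word_tensor_def intro!: sum.neutral)
  then have supp: "{W. ?f W \<noteq> 0} \<subseteq> {W. set W \<subseteq> X \<and> length W = length u}" by blast
  then have "?f \<in> carrier (tensor_algebra X)"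
    using finite_subset[OF supp finite_lists_length_eq[OF \<open>finite X\<close>]] by (auto simp: tensor_algebra_def)
  moreover have "homogeneous_part (length u) ?f = ?f"
    using zero by (auto simp: homogeneous_part_def)
  moreover have "quantum_symmetrizer X c (length u) ?f \<noteq> (\<lambda>w. 0)"
    using quantum_symmetrizer_word_tensor[OF diag \<open>finite I\<close> dual u, where h = h] h by auto
  ultimately show "\<exists>n\<ge>N. \<exists>f\<in>carrier (tensor_algebra X).
      homogeneous_part n f = f \<and> quantum_symmetrizer X c n f \<noteq> (\<lambda>w. 0)"
    using N by blast
qed

section \<open>Diagonal subspaces of Yetter-Drinfeld modules\<close>

lemma hom_GL_group_mult:
  assumes "\<rho> \<in> hom H GL_group" "x \<in> carrier H" "y \<in> carrier H"
  shows "\<rho> (x \<otimes>\<^bsub>H\<^esub> y) *v w = \<rho> x *v (\<rho> y *v w)"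
  using hom_mult[OF assms] by (simp add: GL_group_def matrix_vector_mul_assoc)

lemma hom_GL_group_idem:
  assumes "\<rho> \<in> hom H GL_group" "x \<in> carrier H" "x \<otimes>\<^bsub>H\<^esub> x = x"
  shows "\<rho> x *v w = w"
proof -
  have "\<rho> x ** \<rho> x = \<rho> x" "invertible (\<rho> x)"
    using hom_mult[OF assms(1,2,2)] hom_in_carrier[OF assms(1,2)] assms(3)
    by (auto simp: GL_group_def)
  then have "\<rho> x = mat 1"
    by (metis invertible_def matrix_mul_assoc matrix_mul_lid)
  then show ?thesis by simp
qed

lemma (in group) inv_mult_cancel:
  assumes "x \<in> carrier G" "y \<in> carrier G"
  shows "inv x \<otimes> (x \<otimes> y) = y" "x \<otimes> (inv x \<otimes> y) = y"
  using assms by (simp_all add: m_assoc[symmetric])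

lemma (in group) subgroup_centralizer:
  assumes s: "s \<in> carrier G"
  shows "subgroup (centralizer G s) G"
proof
  fix x y
  assume x: "x \<in> centralizer G s" and y: "y \<in> centralizer G s"
  then have "x \<otimes> y \<otimes> s = x \<otimes> (s \<otimes> y)" using s by (simp add: centralizer_def m_assoc)
  also have "\<dots> = x \<otimes> s \<otimes> y" using x y s by (subst m_assoc) (auto simp: centralizer_def)
  also have "x \<otimes> s = s \<otimes> x" using x by (simp add: centralizer_def)
  also have "s \<otimes> x \<otimes> y = s \<otimes> (x \<otimes> y)" using x y s by (simp add: centralizer_def m_assoc)
  finally show "x \<otimes> y \<in> centralizer G s" using x y by (simp add: centralizer_def)
next
  fix x
  assume "x \<in> centralizer G s"
  then have x: "x \<in> carrier G" and comm: "x \<otimes> s = s \<otimes> x" by (auto simp: centralizer_def)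
  have "inv x \<otimes> s = inv x \<otimes> (s \<otimes> x) \<otimes> inv x" using x s by (simp add: m_assoc)
  also have "\<dots> = s \<otimes> inv x"
    unfolding comm[symmetric] using x s by (simp add: m_assoc inv_mult_cancel)
  finally show "inv x \<in> centralizer G s" using x by (simp add: centralizer_def)
qed (use s in \<open>auto simp: centralizer_def\<close>)

locale yd_module = group G for G (structure) +
  fixes s g and \<rho> :: "'a \<Rightarrow> complex^'n^'n"
  assumes finite_carrier: "finite (carrier G)"
    and s_closed [simp]: "s \<in> carrier G"
    and transversal: "conj_transversal G s g"
    and rep: "\<rho> \<in> hom (centralizer_group G s) GL_group"
begin

lemmas centralizer_mult = subgroup.m_closed[OF subgroup_centralizer[OF s_closed]]
lemmas centralizer_inv = subgroup.m_inv_closed[OF subgroup_centralizer[OF s_closed]]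

lemma conj_class_iff: "t \<in> conj_class G s \<longleftrightarrow> (\<exists>h\<in>carrier G. t = h \<otimes> s \<otimes> inv h)"
  by (auto simp: conj_class_def orbit_def conj_by_def)

lemma conj_class_closed: "t \<in> conj_class G s \<Longrightarrow> t \<in> carrier G"
  by (auto simp: conj_class_iff)

lemma finite_conj_class [simp]: "finite (conj_class G s)"
  using finite_carrier by (rule finite_subset[rotated]) (auto simp: conj_class_closed)

lemma conj_class_self: "s \<in> conj_class G s"
  unfolding conj_class_iff by (rule bexI[of _ \<one>]) auto

lemma g_closed: "t \<in> conj_class G s \<Longrightarrow> g t \<in> carrier G"
  using transversal by (auto simp: conj_transversal_def)

lemma g_conj: "t \<in> conj_class G s \<Longrightarrow> inv (g t) \<otimes> t \<otimes> g t = s"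
proof -
  assume t: "t \<in> conj_class G s"
  then have "g t \<otimes> s \<otimes> inv (g t) = t"
    using transversal by (auto simp: conj_transversal_def conj_by_def)
  then have "inv (g t) \<otimes> t \<otimes> g t = inv (g t) \<otimes> (g t \<otimes> s \<otimes> inv (g t)) \<otimes> g t" by simp
  then show ?thesis
    using g_closed[OF t] by (simp add: m_assoc inv_mult_cancel)
qed

lemma centralizer_closed: "x \<in> centralizer G s \<Longrightarrow> x \<in> carrier G"
  by (simp add: centralizer_def)

lemma rep_mult:
  "x \<in> centralizer G s \<Longrightarrow> y \<in> centralizer G s \<Longrightarrow> \<rho> (x \<otimes> y) *v w = \<rho> x *v (\<rho> y *v w)"
  using hom_GL_group_mult[OF rep, of x y] by simp

lemma centralizer_self: "s \<in> centralizer G s" and centralizer_one: "\<one> \<in> centralizer G s"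
  by (auto simp: centralizer_def)

lemma rep_one: "\<rho> \<one> *v w = w"
  using hom_GL_group_idem[OF rep, of \<one>] centralizer_one by simp

text \<open>Conjugation by \<open>g t\<close> carries the centralizer of \<open>t\<close> to that of \<open>s\<close>.\<close>

definition transport :: "'a \<Rightarrow> 'a \<Rightarrow> 'a" where
  "transport t x = inv (g t) \<otimes> x \<otimes> g t"

lemma transport_mult:
  assumes "t \<in> conj_class G s" "x \<in> carrier G" "y \<in> carrier G"
  shows "transport t (x \<otimes> y) = transport t x \<otimes> transport t y"
proof -
  note [simp] = g_closed[OF assms(1)] assms
  show ?thesis by (simp add: transport_def m_assoc inv_mult_cancel)
qed

lemma transport_self: "t \<in> conj_class G s \<Longrightarrow> transport t t = s"
  by (simp add: transport_def g_conj)

lemma transport_centralizer: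
  assumes "t \<in> conj_class G s" "x \<in> carrier G" "x \<otimes> t = t \<otimes> x"
  shows "transport t x \<in> centralizer G s"
proof -
  have t: "t \<in> carrier G" using assms conj_class_closed by auto
  have "transport t x \<in> carrier G" using assms g_closed by (auto simp: transport_def)
  moreover have "transport t x \<otimes> s = s \<otimes> transport t x"
    using transport_mult[OF assms(1,2) t] transport_mult[OF assms(1) t assms(2)] assms
    by (simp add: transport_self)
  ultimately show ?thesis by (simp add: centralizer_def)
qed

text \<open>If t commutes with u, conjugation by t fixes the degree u, so t acts inside the
  component of u, through \<open>transport u t\<close>.\<close>

lemma yd_action_yd_elem:
  assumes t: "t \<in> carrier G" and u: "u \<in> conj_class G s" and comm: "t \<otimes> u = u \<otimes> t"
  shows "yd_action G s g \<rho> t (yd_elem u w) = yd_elem u (\<rho> (transport u t) *v w)"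
proof
  fix y
  have "conj_by G t u = u"
    using t conj_class_closed[OF u] by (simp add: conj_by_def comm m_assoc)
  have "yd_action G s g \<rho> t (yd_elem u w) y = (\<Sum>r\<in>conj_class G s. if r = u then
      yd_elem (conj_by G t u) (\<rho> (inv (g (conj_by G t u)) \<otimes> t \<otimes> g u) *v w) y else 0)"
    unfolding yd_action_def by (rule sum.cong) (auto simp: yd_elem_def Let_def)
  also have "\<dots> = yd_elem u (\<rho> (transport u t) *v w) y"
    using u \<open>conj_by G t u = u\<close> by (simp add: transport_def)
  finally show "yd_action G s g \<rho> t (yd_elem u w) y = yd_elem u (\<rho> (transport u t) *v w) y" .
qed

text \<open>The braiding lets t act on the component of degree u and then exchanges the factors. So
  it suffices that \<open>v u\<close> is an eigenvector of every t in I acting there.\<close>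

lemma yd_braiding_diagonal_on:
  assumes I: "I \<subseteq> conj_class G s"
    and comm: "\<And>t u. t \<in> I \<Longrightarrow> u \<in> I \<Longrightarrow> t \<otimes> u = u \<otimes> t"
    and eig: "\<And>t u. t \<in> I \<Longrightarrow> u \<in> I \<Longrightarrow> \<rho> (transport u t) *v v u = q t u *s v u"
  shows "diagonal_on (yd_basis G s) (yd_braiding G s g \<rho>) I (\<lambda>t (u, k). if u = t then v t $ k else 0) q"
  unfolding diagonal_on_def
proof (intro ballI allI)
  fix a b and y z :: "'a \<times> 'n"
  assume a: "a \<in> I" and b: "b \<in> I"
  obtain y1 y2 where y: "y = (y1, y2)" by (cases y)
  obtain z1 z2 where z: "z = (z1, z2)" by (cases z)
  let ?x = "\<lambda>t (u, k). if u = t then v t $ k else 0" and ?c = "yd_braiding G s g \<rho>"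
  have ab: "a \<in> conj_class G s" "b \<in> conj_class G s" using a b I by auto
  have col: "(A *v axis l 1) $ i = A $ i $ l" for A :: "complex^'n^'n" and i l
    by (simp add: matrix_vector_mult_def axis_def if_distrib cong: if_cong)
  have c: "?c (a, k) (b, l) (y, z) =
      (if y1 = b then \<rho> (transport b a) $ y2 $ l else 0) * (if z = (a, k) then 1 else 0)" for k l
    using yd_action_yd_elem[OF conj_class_closed[OF ab(1)] ab(2) comm[OF a b], of "axis l 1"]
    by (simp add: yd_braiding_def y yd_elem_def col)
  have single: "(\<Sum>t\<in>yd_basis G s. ?x r t * f t) = (\<Sum>k\<in>UNIV. v r $ k * f (r, k))"
    if "r \<in> conj_class G s" for r f
  proof -
    have "(\<Sum>t\<in>yd_basis G s. ?x r t * f t) =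
      (\<Sum>t\<in>conj_class G s. \<Sum>k\<in>UNIV. (if t = r then v r $ k else 0) * f (t, k))"
      unfolding yd_basis_def sum.cartesian_product by (simp add: case_prod_unfold)
    also have "\<dots> = (\<Sum>t\<in>conj_class G s. if t = r then \<Sum>k\<in>UNIV. v r $ k * f (r, k) else 0)"
      by (rule sum.cong) auto
    finally show ?thesis using that by simp
  qed
  have "(\<Sum>t\<in>yd_basis G s. \<Sum>u\<in>yd_basis G s. ?x a t * ?x b u * ?c t u (y, z)) =
    (\<Sum>t\<in>yd_basis G s. ?x a t * (\<Sum>u\<in>yd_basis G s. ?x b u * ?c t u (y, z)))"
    by (simp add: sum_distrib_left mult.assoc)
  also have "\<dots> = (\<Sum>k\<in>UNIV. v a $ k * (\<Sum>l\<in>UNIV. v b $ l * ?c (a, k) (b, l) (y, z)))"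
    by (simp only: single ab)
  also have "\<dots> = (\<Sum>k\<in>UNIV. v a $ k * (if z = (a, k) then 1 else 0)) *
      (if y1 = b then \<Sum>l\<in>UNIV. \<rho> (transport b a) $ y2 $ l * v b $ l else 0)"
    by (simp add: c sum_distrib_left sum_distrib_right mult_ac)
  also have "(\<Sum>k\<in>UNIV. v a $ k * (if z = (a, k) then 1 else 0)) = ?x a z"
    by (auto simp: z if_distrib cong: if_cong)
  also have "(\<Sum>l\<in>UNIV. \<rho> (transport b a) $ y2 $ l * v b $ l) = (\<rho> (transport b a) *v v b) $ y2"
    by (simp add: matrix_vector_mult_def)
  also have "\<dots> = q a b * v b $ y2" by (simp add: eig a b)
  finally show "(\<Sum>t\<in>yd_basis G s. \<Sum>u\<in>yd_basis G s. ?x a t * ?x b u * ?c t u (y, z)) =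
      q a b * (?x b y * ?x a z)"
    by (simp add: y)
qed

text \<open>Vectors in different degrees have disjoint supports; hence one nonvanishing coordinate
  of each, scaled to 1, provides the dual letters.\<close>

lemma infinite_dim_of_diagonal:
  assumes I: "I \<subseteq> conj_class G s"
    and comm: "\<And>t u. t \<in> I \<Longrightarrow> u \<in> I \<Longrightarrow> t \<otimes> u = u \<otimes> t"
    and eig: "\<And>t u. t \<in> I \<Longrightarrow> u \<in> I \<Longrightarrow> \<rho> (transport u t) *v v u = q t u *s v u"
    and nz: "\<And>t. t \<in> I \<Longrightarrow> v t \<noteq> 0"
    and w: "set w \<subseteq> I" "w \<noteq> []"
    and high: "\<And>m. \<exists>h. iter_deriv q (concat (replicate m w)) h [] \<noteq> 0"
  shows "\<not> nichols_finite_dim (yd_basis G s) (yd_braiding G s g \<rho>)"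
proof -
  have "\<forall>t\<in>I. \<exists>k. v t $ k \<noteq> 0"
    using nz by (metis vec_eq_iff zero_index)
  then obtain \<kappa> where \<kappa>: "\<And>t. t \<in> I \<Longrightarrow> v t $ \<kappa> t \<noteq> 0" by metis
  define v' where "v' t = inverse (v t $ \<kappa> t) *s v t" for t
  show ?thesis
  proof (rule not_nichols_finite_dim_diagonal[OF _ yd_braiding_diagonal_on[OF I comm, of v' q]])
    show "\<rho> (transport u t) *v v' u = q t u *s v' u" if "t \<in> I" "u \<in> I" for t u
      using eig[OF that] by (simp add: v'_def vector_scalar_commute mult.commute)
    show "finite (yd_basis G s :: ('a \<times> 'n) set)" by (simp add: yd_basis_def)
    show "finite I" using I by (rule finite_subset) simp
    show "(case t of (u, k) \<Rightarrow> if u = a then v' a $ k else 0) \<noteq> 0 \<Longrightarrow> t \<in> yd_basis G s" if "a \<in> I" for a t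
      using that I by (cases t) (auto simp: yd_basis_def split: if_splits)
    show "(case (b, \<kappa> b) of (u, k) \<Rightarrow> if u = a then v' a $ k else 0) = (if a = b then 1 else 0)"
      if "a \<in> I" "b \<in> I" for a b
      using \<kappa> that by (auto simp: v'_def)
  qed (use w high in auto)
qed

section \<open>Infinite dimension: scalar 1, scalars other than 1 and -1, and triangles at
  -1\<close>

lemma infinite_dim_trivial:
  assumes "\<And>w. \<rho> s *v w = w"
  shows "\<not> nichols_finite_dim (yd_basis G s) (yd_braiding G s g \<rho>)"
\<comment> \<open>The index \<open>undefined\<close> is arbitrary: any nonzero vector of V
  serves.\<close>
proof (rule infinite_dim_of_diagonal[where q = "\<lambda>_ _. 1" and I = "{s}" and w = "[s]" and v = "\<lambda>_. axis undefined 1"])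
  show "\<exists>h. iter_deriv (\<lambda>_ _. 1) (concat (replicate m [s])) h [] \<noteq> 0" for m
    by (rule iter_deriv_rank1) simp
  show "axis undefined 1 \<noteq> (0 :: complex^'n)" by (simp add: axis_eq_0_iff)
qed (use conj_class_self in \<open>auto simp: transport_self assms\<close>)

text \<open>On the degrees s and \<open>inv s\<close> an element acts by q on its own component and
  by 1/q on the other. So the four entries have product 1, and the edge label q^-2 differs from
  1.\<close>

lemma infinite_dim_real:
  assumes scalar: "\<And>w. \<rho> s *v w = q *s w" and "inv s \<in> conj_class G s" and "q\<^sup>2 \<noteq> 1" "q \<noteq> 0"
  shows "\<not> nichols_finite_dim (yd_basis G s) (yd_braiding G s g \<rho>)"
proof -
  note cl = conj_class_self assms(2)
  have inv_s: "inv s \<in> centralizer G s" by (simp add: centralizer_def)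
  have scalar_inv: "\<rho> (inv s) *v w = inverse q *s w" for w
  proof -
    have "w = \<rho> (inv s) *v (\<rho> s *v w)"
      using rep_mult[OF inv_s centralizer_self, of w] by (simp add: rep_one)
    also have "\<dots> = q *s (\<rho> (inv s) *v w)"
      by (simp add: scalar vector_scalar_commute)
    finally have "inverse q *s w = inverse q *s (q *s (\<rho> (inv s) *v w))" by simp
    then show ?thesis using \<open>q \<noteq> 0\<close> by simp
  qed
  have "s \<noteq> inv s"
  proof
    assume "s = inv s"
    then have "q *s axis undefined 1 = inverse q *s (axis undefined 1 :: complex^'n)"
      using scalar scalar_inv by metis
    then have "q = inverse q" by (metis axis_nth mult.right_neutral vector_smult_component)
    then show False using \<open>q\<^sup>2 \<noteq> 1\<close> \<open>q \<noteq> 0\<close> by (simp add: power2_eq_square field_simps)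
  qed
  have tr_inv: "transport t (inv t) = inv s" if "t \<in> conj_class G s" for t
  proof -
    have t: "t \<in> carrier G" using conj_class_closed that .
    have "transport t (inv t) \<otimes> s = transport t (inv t \<otimes> t)"
      using transport_mult[OF that inv_closed[OF t] t] by (simp add: transport_self that)
    also have "\<dots> = \<one>" using t g_closed[OF that] by (simp add: transport_def)
    finally show ?thesis
      using transport_centralizer[OF that inv_closed[OF t]] t
      by (intro inv_equality[symmetric]) (auto simp: centralizer_closed)
  qed
  define Q where "Q t u = (if t = u then q else inverse q)" for t u :: 'a
  show ?thesis
  proof (rule infinite_dim_of_diagonal[where q = Q and I = "{s, inv s}" and w = "[s, inv s]" and v = "\<lambda>_. axis undefined 1"])
    have "inverse q * inverse q \<noteq> 1"
      using \<open>q\<^sup>2 \<noteq> 1\<close> \<open>q \<noteq> 0\<close> by (simp add: power2_eq_square field_simps)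
    moreover have "q * q * inverse q * inverse q = 1"
      using \<open>q \<noteq> 0\<close> by (simp add: field_simps)
    ultimately show "\<exists>h. iter_deriv Q (concat (replicate m [s, inv s])) h [] \<noteq> 0" for m
      using \<open>s \<noteq> inv s\<close> by (intro iter_deriv_rank2) (auto simp: Q_def)
    show "\<rho> (transport u t) *v axis undefined 1 = Q t u *s axis undefined 1"
      if "t \<in> {s, inv s}" "u \<in> {s, inv s}" for t u
      using that cl tr_inv[of s] tr_inv[of "inv s"] \<open>s \<noteq> inv s\<close>
      by (auto simp: Q_def transport_self scalar scalar_inv)
    show "axis undefined 1 \<noteq> (0 :: complex^'n)" by (simp add: axis_eq_0_iff)
  qed (use cl in auto)
qed

text \<open>
  Conjugation by \<open>k\<close> turns \<open>u\<close> into \<open>t u\<close>, that is, into \<open>-u\<close> on the degree \<open>t\<close> component; so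
  \<open>u\<close> has both eigenvalues there.
\<close>

lemma exists_fixed_vector:
  assumes scalar: "\<And>w. \<rho> s *v w = - w" and t: "t \<in> conj_class G s" and u: "u \<in> carrier G"
    and "u \<otimes> t = t \<otimes> u" "u \<otimes> u = \<one>"
    and k: "k \<in> carrier G" "k \<otimes> t = t \<otimes> k" "k \<otimes> u = t \<otimes> u \<otimes> k"
  shows "\<exists>v. v \<noteq> 0 \<and> \<rho> (transport t u) *v v = v"
proof -
  have tc: "t \<in> carrier G" using t conj_class_closed by auto
  note cent = transport_centralizer[OF t u assms(4)] transport_centralizer[OF t k(1,2)]
  define A where "A w = \<rho> (transport t u) *v w" for w
  define P where "P w = \<rho> (transport t k) *v w" for w
  have lin: "A (x + y) = A x + A y" "P (- x) = - P x" for x y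
    by (simp_all add: A_def P_def matrix_vector_right_distrib) (simp add: vec_eq_iff matrix_vector_mult_def sum_negf)
  have AA: "A (A w) = w" for w
  proof -
    have "transport t u \<otimes> transport t u = \<one>"
      using transport_mult[OF t u u] g_closed[OF t] assms(5) by (simp add: transport_def)
    then show ?thesis
      using rep_mult[OF cent(1,1), of w] by (simp add: A_def rep_one)
  qed
  have PA: "P (A w) = - A (P w)" for w
  proof -
    have "transport t k \<otimes> transport t u = s \<otimes> transport t u \<otimes> transport t k"
      using transport_mult[OF t k(1) u] transport_mult[OF t tc u] transport_mult[OF t m_closed[OF tc u] k(1)] k(3)
      by (simp add: transport_self[OF t])
    then have "\<rho> (transport t k) *v (\<rho> (transport t u) *v w) = \<rho> (s \<otimes> transport t u \<otimes> transport t k) *v w"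
      using rep_mult[OF cent(2,1), of w] by simp
    also have "\<dots> = - (\<rho> (transport t u) *v (\<rho> (transport t k) *v w))"
      by (simp add: rep_mult centralizer_mult centralizer_self cent scalar)
    finally show ?thesis by (simp add: A_def P_def)
  qed
  define e :: "complex^'n" where "e = axis undefined 1"
  have "e \<noteq> 0" by (simp add: e_def axis_eq_0_iff)
  show ?thesis
  \<comment> \<open>The sum \<open>e + A e\<close> is fixed by the involution A. If it vanishes, A
    negates e, and P turns e into a fixed vector.\<close>
  proof (cases "e + A e = 0")
    case False
    have "A (e + A e) = e + A e" by (simp add: lin AA add.commute)
    then show ?thesis using False by (auto simp: A_def)
  next
    case True
    then have e: "A e = - e" by (simp add: eq_neg_iff_add_eq_0 add.commute)
    then have "A (P e) = P e" using PA[of e] by (simp add: lin)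
    moreover have "P e \<noteq> 0"
    proof
      assume "P e = 0"
      then have "e = 0"
        using rep_mult[OF centralizer_inv cent(2), of "transport t k" e] cent(2)
        by (simp add: P_def rep_one centralizer_closed)
      then show False using \<open>e \<noteq> 0\<close> by simp
    qed
    ultimately show ?thesis by (auto simp: A_def)
  qed
qed

text \<open>In each degree take a vector fixed by the next involution in cyclic order; the third
  one, a product of these two, then acts on it by -1. So each edge has one entry 1 and one entry -1,
  with product -1. Each k centralizes one involution and swaps the other two, as
  \<open>exists_fixed_vector\<close> requires.\<close>

lemma infinite_dim_triangle:
  assumes scalar: "\<And>w. \<rho> s *v w = - w"
    and t: "t1 \<in> conj_class G s" "t2 \<in> conj_class G s" "t3 \<in> conj_class G s"
    and "distinct [t1, t2, t3]" and sq: "t1 \<otimes> t1 = \<one>" "t2 \<otimes> t2 = \<one>" "t3 \<otimes> t3 = \<one>"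
    and m: "t1 \<otimes> t2 = t3" "t2 \<otimes> t3 = t1" "t3 \<otimes> t1 = t2"
      "t2 \<otimes> t1 = t3" "t3 \<otimes> t2 = t1" "t1 \<otimes> t3 = t2"
    and k1: "k1 \<in> carrier G" "k1 \<otimes> t1 = t1 \<otimes> k1" "k1 \<otimes> t2 = t3 \<otimes> k1"
    and k2: "k2 \<in> carrier G" "k2 \<otimes> t2 = t2 \<otimes> k2" "k2 \<otimes> t3 = t1 \<otimes> k2"
    and k3: "k3 \<in> carrier G" "k3 \<otimes> t3 = t3 \<otimes> k3" "k3 \<otimes> t1 = t2 \<otimes> k3"
  shows "\<not> nichols_finite_dim (yd_basis G s) (yd_braiding G s g \<rho>)"
proof -
  note tc = t[THEN conj_class_closed]
  obtain v1 where v1: "v1 \<noteq> 0" "\<rho> (transport t1 t2) *v v1 = v1"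
    using exists_fixed_vector[OF scalar t(1) tc(2) _ sq(2) k1(1,2)] k1(3) m by auto
  obtain v2 where v2: "v2 \<noteq> 0" "\<rho> (transport t2 t3) *v v2 = v2"
    using exists_fixed_vector[OF scalar t(2) tc(3) _ sq(3) k2(1,2)] k2(3) m by auto
  obtain v3 where v3: "v3 \<noteq> 0" "\<rho> (transport t3 t1) *v v3 = v3"
    using exists_fixed_vector[OF scalar t(3) tc(1) _ sq(1) k3(1,2)] k3(3) m by auto
  have neg: "\<rho> (transport t (t \<otimes> u)) *v v = - v"
    if "\<rho> (transport t u) *v v = v" "t \<in> conj_class G s" "u \<in> carrier G" "u \<otimes> t = t \<otimes> u" for t u v
    using that rep_mult[OF centralizer_self transport_centralizer[OF that(2-4)], of v] conj_class_closed[OF that(2)]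
    by (simp add: transport_mult transport_self scalar)
  have v1': "\<rho> (transport t1 t3) *v v1 = - v1" using neg[OF v1(2) t(1) tc(2)] m by simp
  have v2': "\<rho> (transport t2 t1) *v v2 = - v2" using neg[OF v2(2) t(2) tc(3)] m by simp
  have v3': "\<rho> (transport t3 t2) *v v3 = - v3" using neg[OF v3(2) t(3) tc(1)] m by simp
  define q where "q t u = (if (t, u) \<in> {(t2, t1), (t3, t2), (t1, t3)} then 1 else - 1 :: complex)" for t u
  show ?thesis
  proof (rule infinite_dim_of_diagonal[where q = q and I = "{t1, t2, t3}" and w = "[t1, t3, t2]" and
        v = "\<lambda>t. if t = t1 then v1 else if t = t2 then v2 else v3"])
    show "\<exists>h. iter_deriv q (concat (replicate m [t1, t3, t2])) h [] \<noteq> 0" for m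
      using assms(5) by (intro iter_deriv_rank3) (auto simp: q_def)
    show "\<rho> (transport u t) *v (if u = t1 then v1 else if u = t2 then v2 else v3) =
        q t u *s (if u = t1 then v1 else if u = t2 then v2 else v3)"
      if "t \<in> {t1, t2, t3}" "u \<in> {t1, t2, t3}" for t u
      using that assms(5)
      by (auto simp: q_def transport_self t scalar v1 v2 v3 v1' v2' v3')
  qed (use t m assms(5) v1 v2 v3 in auto)
qed

end

section \<open>Schur's lemma for the distinguished element\<close>

definition poly_act :: "complex^'n^'n \<Rightarrow> complex poly \<Rightarrow> complex^'n \<Rightarrow> complex^'n" where
  "poly_act A p v = fold_coeffs (\<lambda>a u. a *s v + A *v u) p 0"

lemma poly_act_0 [simp]: "poly_act A 0 v = 0"
  by (simp add: poly_act_def)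

lemma poly_act_pCons [simp]: "poly_act A (pCons a p) v = a *s v + A *v poly_act A p v"
  by (cases "a = 0 \<and> p = 0") (auto simp: poly_act_def)

lemma poly_act_add: "poly_act A (p + r) v = poly_act A p v + poly_act A r v"
  by (induction p r rule: poly_induct2)
    (auto simp: matrix_vector_right_distrib algebra_simps)

lemma poly_act_smult: "poly_act A (Polynomial.smult c p) v = c *s poly_act A p v"
  by (induction p) (auto simp: vector_add_ldistrib vector_scalar_commute vector_smult_assoc)

text \<open>Split a root z off an annihilating polynomial of least degree, p = (X - z) r: the vector
  r(A) v is nonzero by minimality and is an eigenvector for z.\<close>

lemma eigenvector_of_poly_act:
  fixes A :: "complex^'n^'n"
  assumes "p \<noteq> 0" "poly_act A p v = 0" "v \<noteq> 0"
  shows "\<exists>z w. w \<noteq> 0 \<and> A *v w = z *s w"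
proof -
  obtain p where p: "p \<noteq> 0" "poly_act A p v = 0"
    and min: "\<And>r. r \<noteq> 0 \<Longrightarrow> poly_act A r v = 0 \<Longrightarrow> degree p \<le> degree r"
    using ex_has_least_nat[of "\<lambda>p. p \<noteq> 0 \<and> poly_act A p v = 0" p degree] assms by auto
  have "degree p \<noteq> 0"
  proof
    assume "degree p = 0"
    then obtain a where "p = [:a:]" by (rule degree_eq_zeroE)
    then show False using p \<open>v \<noteq> 0\<close> by simp
  qed
  then obtain z where "poly p z = 0"
    using fundamental_theorem_of_algebra[of p] by (auto simp: constant_degree)
  then obtain r where r: "p = [:- z, 1:] * r"
    by (metis dvdE poly_eq_0_iff_dvd)
  then have "r \<noteq> 0" using p by auto
  then have "degree r < degree p"
    unfolding r by (subst degree_mult_eq) auto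
  then have "poly_act A r v \<noteq> 0" using min[of r] \<open>r \<noteq> 0\<close> by auto
  moreover have "A *v poly_act A r v = z *s poly_act A r v"
  proof -
    have "p = Polynomial.smult (- z) r + pCons 0 r" by (simp add: r)
    then have "(- z) *s poly_act A r v + A *v poly_act A r v = 0"
      using p(2) by (metis add_0 poly_act_add poly_act_pCons poly_act_smult vector_smult_lzero)
    then show ?thesis by (metis add_eq_0_iff minus_minus vector_smult_lneg)
  qed
  ultimately show ?thesis by blast
qed

text \<open>As s is central in its centralizer, its eigenspaces are invariant. An eigenvector exists
  because X^n - 1, with n the group order, annihilates \<open>\<rho> s\<close>.\<close>

lemma (in yd_module) scalar_of_irreducible:
  assumes irr: "irreducible_rep (centralizer_group G s) \<rho>"
  obtains q where "q \<noteq> 0" "\<And>w. \<rho> s *v w = q *s w"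
proof -
  have pow: "s [^] n \<in> centralizer G s \<and> poly_act (\<rho> s) (Polynomial.monom 1 n) w = \<rho> (s [^] n) *v w" for n w
  proof (induction n)
    case 0
    then show ?case by (simp add: centralizer_one rep_one monom_0)
  next
    case (Suc n)
    moreover have "s [^] Suc n = s \<otimes> s [^] n" by (rule nat_pow_Suc2) simp
    ultimately show ?case
      by (simp del: nat_pow_Suc add: monom_Suc rep_mult centralizer_self centralizer_mult)
  qed
  define e :: "complex^'n" where "e = axis undefined 1"
  have "e \<noteq> 0" by (simp add: e_def axis_eq_0_iff)
  have "order G > 0" using finite_carrier by (simp add: order_gt_0_iff_finite)
  then have "Polynomial.monom 1 (order G) \<noteq> [:1 :: complex:]"
    by (metis degree_monom_eq degree_pCons_0 less_irrefl zero_neq_one)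
  then have "Polynomial.monom 1 (order G) + [:-1 :: complex:] \<noteq> 0"
    by (metis add_eq_0_iff2 minus_minus minus_pCons minus_zero)
  moreover have "poly_act (\<rho> s) (Polynomial.monom 1 (order G) + [:-1:]) e = 0"
    using pow[of "order G" e] by (simp add: poly_act_add pow_order_eq_1 rep_one)
  ultimately obtain q w where w: "w \<noteq> 0" "\<rho> s *v w = q *s w"
    using eigenvector_of_poly_act \<open>e \<noteq> 0\<close> by blast
  let ?W = "{w. \<rho> s *v w = q *s w}"
  have "vec.subspace ?W"
    unfolding vec.subspace_def
    by (auto simp: matrix_vector_right_distrib vector_add_ldistrib vector_scalar_commute vector_smult_assoc mult.commute)
  moreover have "\<rho> x *v v \<in> ?W" if "x \<in> centralizer G s" "v \<in> ?W" for x v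
  proof -
    have "\<rho> s *v (\<rho> x *v v) = \<rho> x *v (\<rho> s *v v)"
      using that rep_mult[OF centralizer_self that(1), of v] rep_mult[OF that(1) centralizer_self, of v]
      by (simp add: centralizer_def)
    then show ?thesis using that by (simp add: vector_scalar_commute)
  qed
  ultimately have "?W = UNIV"
    using irr w unfolding irreducible_rep_def by (auto 0 3)
  then have all: "\<rho> s *v w = q *s w" for w by blast
  moreover have "q \<noteq> 0"
  proof
    assume "q = 0"
    then have "\<rho> s *v w = 0" using all by simp
    moreover have "invertible (\<rho> s)"
      using hom_in_carrier[OF rep, of s] centralizer_self by (simp add: GL_group_def)
    ultimately show False using w(1)
      by (metis invertible_def matrix_vector_mul_assoc matrix_vector_mul_lid matrix_vector_mult_0_right)
  qed
  ultimately show thesis using that by blast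
qed

section \<open>Cycle types\<close>

primrec cycle_prod :: "'a list list \<Rightarrow> 'a \<Rightarrow> 'a" where
  "cycle_prod [] = id"
| "cycle_prod (c # cs) = cycle_of_list c \<circ> cycle_prod cs"

text \<open>A cycle decomposition may contain cycles of length at most 1; dropping these identities
  bounds the number of cycles.\<close>

lemma exists_cycle_prod:
  assumes "cycle_decomp S p"
  shows "\<exists>cs. distinct (concat cs) \<and> set (concat cs) \<subseteq> S \<and> (\<forall>c\<in>set cs. 2 \<le> length c) \<and> p = cycle_prod cs"
  using assms
proof induction
  case empty
  show ?case by (rule exI[of _ "[]"]) simp
next
  case (comp I p c)
  then obtain cs where cs: "distinct (concat cs)" "set (concat cs) \<subseteq> I" "\<forall>c\<in>set cs. 2 \<le> length c"
    "p = cycle_prod cs" by auto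
  show ?case
  proof (cases "2 \<le> length c")
    case True
    then have "distinct (concat (c # cs)) \<and> set (concat (c # cs)) \<subseteq> set c \<union> I \<and>
        (\<forall>d\<in>set (c # cs). 2 \<le> length d) \<and> cycle_of_list c \<circ> p = cycle_prod (c # cs)"
      using cs comp by auto
    then show ?thesis by blast
  next
    case False
    then have "cycle_of_list c = id"
      by (cases c rule: cycle_of_list.cases) auto
    then show ?thesis using cs by (intro exI[of _ cs]) auto
  qed
qed

lemma permutation_cycle_prod: "permutation (cycle_prod cs)"
proof (induction cs)
  case (Cons c cs)
  then show ?case
    using permutation_compose[OF permutation_of_cycle, of "cycle_prod cs" c] by (simp add: comp_def)
qed (simp add: permutation_id[unfolded id_def])

text \<open>A cycle of length l is a product of l - 1 transpositions; truncated subtraction covers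
  the empty list.\<close>

lemma evenperm_cycle_of_list: "distinct c \<Longrightarrow> evenperm (cycle_of_list c) \<longleftrightarrow> even (length c - 1)"
  by (induction c rule: cycle_of_list.induct)
    (auto simp: evenperm_comp permutation_swap_id permutation_of_cycle evenperm_swap)

lemma evenperm_cycle_prod:
  "\<forall>c\<in>set cs. distinct c \<Longrightarrow> evenperm (cycle_prod cs) \<longleftrightarrow> even (\<Sum>c\<leftarrow>cs. length c - 1)"
proof (induction cs)
  case (Cons c cs)
  then show ?case
    using evenperm_comp[OF permutation_of_cycle[of c] permutation_cycle_prod[of cs]]
    by (auto simp: evenperm_cycle_of_list comp_def)
qed simp

section \<open>Relabelling of cycle products and the even cycle types on six letters\<close>

lemma conj_cycle_prod:
  assumes "bij h" "\<forall>c\<in>set cs. distinct c"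
  shows "cycle_prod (map (map h) cs) = h \<circ> cycle_prod cs \<circ> inv' h"
  using assms(2)
proof (induction cs)
  case Nil
  then show ?case using assms(1) by (simp add: bij_is_surj fun_eq_iff surj_f_inv_f)
next
  case (Cons c cs)
  have "cycle_of_list (map h c) (h y) = h (cycle_of_list c y)" for y
    using fun_cong[OF conjugation_of_cycle[of c h], of "h y"] assms(1) Cons.prems by (simp add: bij_is_inj)
  then show ?case using Cons by (simp add: fun_eq_iff)
qed

lemma exists_permutes_map_upt:
  assumes "distinct xs" "set xs \<subseteq> {1..m}"
  shows "\<exists>h. h permutes {1..m} \<and> map h [1..<Suc (length xs)] = xs"
proof -
  obtain ys where ys: "set ys = {1..m} - set xs" "distinct ys"
    using finite_distinct_list[of "{1..m} - set xs"] by auto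
  define zs where "zs = xs @ ys"
  have zs: "distinct zs" "set zs = {1..m}" using ys assms by (auto simp: zs_def)
  then have len: "length zs = m" using distinct_card[of zs] by simp
  define h where "h i = (if i \<in> {1..m} then zs ! (i - 1) else i)" for i
  have "bij_betw (\<lambda>i. i - 1) {1..m} {..<m}"
    by (rule bij_betw_byWitness[where f' = Suc]) auto
  moreover have "bij_betw ((!) zs) {..<m} {1..m}"
    using bij_betw_nth[OF zs(1)] zs(2) len by auto
  ultimately have "bij_betw ((!) zs \<circ> (\<lambda>i. i - 1)) {1..m} {1..m}"
    by (rule bij_betw_trans)
  then have "bij_betw h {1..m} {1..m}"
    by (rule bij_betw_cong[THEN iffD1, rotated]) (simp add: h_def)
  then have "h permutes {1..m}"
    by (rule bij_imp_permutes) (metis h_def)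
  moreover have "length xs \<le> m" using len by (simp add: zs_def)
  then have "map h [1..<Suc (length xs)] = xs"
    by (intro nth_equalityI) (auto simp: h_def zs_def nth_append simp del: upt_Suc)
  ultimately show ?thesis by blast
qed

text \<open>Let h send i to the i-th entry of \<open>concat cs\<close>; equal cycle lengths cut both
  concatenations at the same places.\<close>

lemma cycle_prod_relabel:
  assumes "distinct (concat cs)" "set (concat cs) \<subseteq> {1..m}"
    and "map length ds = map length cs" "concat ds = [1..<Suc (length (concat cs))]"
  shows "\<exists>h. h permutes {1..m} \<and> cycle_prod cs = h \<circ> cycle_prod ds \<circ> inv' h"
proof -
  obtain h where h: "h permutes {1..m}" "map h [1..<Suc (length (concat cs))] = concat cs"
    using exists_permutes_map_upt[OF assms(1,2)] by blast
  have "concat (map (map h) ds) = map h (concat ds)" by (simp add: map_concat)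
  also have "\<dots> = concat cs" by (simp only: assms(4) h(2))
  finally have "concat (map (map h) ds) = concat cs" .
  moreover have len: "length ds = length cs" using assms(3) by (metis length_map)
  moreover have "\<forall>(x, y)\<in>set (zip (map (map h) ds) cs). length x = length y"
    using assms(3) len by (auto simp: set_zip) (metis nth_map)
  ultimately have "map (map h) ds = cs"
    by (intro concat_injective) auto
  moreover have "distinct (concat ds)" by (simp add: assms(4) del: upt_Suc)
  then have "\<forall>c\<in>set ds. distinct c" by (auto simp: distinct_concat_iff)
  ultimately show ?thesis
    using conj_cycle_prod[of h ds] h(1) permutes_bij by metis
qed

text \<open>These are lists, so both orders of 2 and 4 survive. Parity removes [2], [4], [6],
  [2, 3], [3, 2] and [2, 2, 2].\<close>

lemma small_partition_cases:
  assumes "\<forall>n\<in>set ns. 2 \<le> (n::nat)" "sum_list ns \<le> 6" "even (\<Sum>n\<leftarrow>ns. n - 1)"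
  shows "ns \<in> {[], [3], [5], [2, 2], [3, 3], [2, 4], [4, 2]}"
proof -
  consider "ns = []" | a where "ns = [a]" | a b where "ns = [a, b]" | a b c where "ns = [a, b, c]"
    | a b c d r where "ns = a # b # c # d # r"
    by (metis list.exhaust)
  then show ?thesis
  proof cases
    case 2
    then have "2 \<le> a" "a \<le> 6" "even (a - 1)" using assms by auto
    then have "a = 3 \<or> a = 5" by presburger
    then show ?thesis using 2 by auto
  next
    case 3
    then have "2 \<le> a" "2 \<le> b" "a + b \<le> 6" "even (a - 1 + (b - 1))" using assms by auto
    then have "(a, b) \<in> {(2, 2), (3, 3), (2, 4), (4, 2)}" by simp presburger
    then show ?thesis using 3 by auto
  next
    case 4
    then have "a = 2" "b = 2" "c = 2" using assms by auto
    then show ?thesis using 4 assms(3) by simp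
  qed (use assms in auto)
qed

abbreviation alt6_reps :: "(nat \<Rightarrow> nat) set" where
  "alt6_reps \<equiv> {id, cycle_of_list [1, 2] \<circ> cycle_of_list [3, 4], cycle_of_list [1, 2, 3],
     cycle_of_list [1, 2, 3] \<circ> cycle_of_list [4, 5, 6], cycle_of_list [1, 2, 3, 4, 5], pi_perm}"

text \<open>The conjugator may be odd: the 5-cycles, for instance, form one class under all
  permutations but two in the alternating group.\<close>

lemma alt6_cycle_type:
  assumes "p permutes {1..6}" "evenperm p"
  shows "\<exists>h. h permutes {1..6} \<and> (\<exists>r\<in>alt6_reps. p = h \<circ> r \<circ> inv' h)"
proof -
  have "cycle_decomp {1..6} p" using cycle_decomposition[OF assms(1)] by simp
  then obtain cs where cs: "distinct (concat cs)" "set (concat cs) \<subseteq> {1..6}" "\<forall>c\<in>set cs. 2 \<le> length c"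
    "p = cycle_prod cs" using exists_cycle_prod by blast
  have "length (concat cs) = card (set (concat cs))" by (rule distinct_card[OF cs(1), symmetric])
  also have "\<dots> \<le> card {1..6::nat}" using cs(2) by (intro card_mono) auto
  finally have len: "sum_list (map length cs) \<le> 6" by (simp add: length_concat)
  have dist: "\<forall>c\<in>set cs. distinct c" using cs(1) by (auto simp: distinct_concat_iff)
  have "even (\<Sum>n\<leftarrow>map length cs. n - 1)"
    using assms(2) evenperm_cycle_prod[OF dist] by (simp add: cs(4) comp_def)
  then have types: "map length cs \<in> {[], [3], [5], [2, 2], [3, 3], [2, 4], [4, 2]}"
    using small_partition_cases[of "map length cs"] cs(3) len by auto
  have relabel: ?thesis if "distinct (concat cs')" "set (concat cs') \<subseteq> {1..6}" "p = cycle_prod cs'"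
    "map length ds = map length cs'" "concat ds = [1..<Suc (sum_list (map length cs'))]"
    "cycle_prod ds \<in> alt6_reps" for cs' ds
    using cycle_prod_relabel[of cs' 6 ds] that by (metis length_concat)
  note upt = upt_conv_Cons eval_nat_numeral
  show ?thesis
  \<comment> \<open>The one type whose cycles come in the wrong order for \<open>pi_perm\<close>;
    the two disjoint cycles are exchanged first.\<close>
  proof (cases "map length cs = [4, 2]")
    case True
    then obtain c d where cd: "cs = [c, d]" "length c = 4" "length d = 2" by auto
    then have "p = cycle_prod [d, c]"
      using cs cycles_commute[of c d] by auto
    then show ?thesis
      by (rule relabel[of "[d, c]" "[[1, 2], [3, 4, 5, 6]]", rotated 2])
        (use cd cs in \<open>auto simp: pi_perm_def upt\<close>)
  next
    case False
    with types consider "map length cs = []" | "map length cs = [3]" | "map length cs = [5]"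
      | "map length cs = [2, 2]" | "map length cs = [3, 3]" | "map length cs = [2, 4]" by auto
    then show ?thesis
    proof cases
      case 1
      show ?thesis by (rule relabel[OF cs(1,2,4), of "[]"]) (use 1 in auto)
    next
      case 2
      show ?thesis by (rule relabel[OF cs(1,2,4), of "[[1, 2, 3]]"]) (unfold 2, auto simp: upt)
    next
      case 3
      show ?thesis by (rule relabel[OF cs(1,2,4), of "[[1, 2, 3, 4, 5]]"]) (unfold 3, auto simp: upt)
    next
      case 4
      show ?thesis by (rule relabel[OF cs(1,2,4), of "[[1, 2], [3, 4]]"]) (unfold 4, auto simp: upt)
    next
      case 5
      show ?thesis by (rule relabel[OF cs(1,2,4), of "[[1, 2, 3], [4, 5, 6]]"]) (unfold 5, auto simp: upt)
    next
      case 6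
      show ?thesis by (rule relabel[OF cs(1,2,4), of "[[1, 2], [3, 4, 5, 6]]"])
        (unfold 6, auto simp: upt pi_perm_def)
    qed
  qed
qed

section \<open>The alternating group on six letters\<close>

abbreviation (input) A6 :: "(nat \<Rightarrow> nat) monoid" where
  "A6 \<equiv> alt_group 6"

abbreviation (input) swap :: "nat \<Rightarrow> nat \<Rightarrow> nat \<Rightarrow> nat" where
  "swap \<equiv> Transposition.transpose"

interpretation A6: group A6
  by (rule alt_group_is_group)

lemma finite_A6: "finite (carrier A6)"
  by (rule finite_subset[OF _ finite_permutations[of "{1..6}"]]) (auto simp: alt_group_carrier)

lemma two_swaps_in_A6:
  assumes "{a, b, c, d} \<subseteq> {1..6}" "a \<noteq> b" "c \<noteq> d"
  shows "swap a b \<circ> swap c d \<in> carrier A6"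
  using assms unfolding alt_group_carrier
  by (auto simp: evenperm_comp evenperm_swap permutation_swap_id intro!: permutes_compose permutes_swap_id)

text \<open>Conjugation by an arbitrary, possibly odd, permutation is an automorphism of the alternating group.\<close>

definition relabel :: "(nat \<Rightarrow> nat) \<Rightarrow> (nat \<Rightarrow> nat) \<Rightarrow> nat \<Rightarrow> nat" where
  "relabel h x = h \<circ> x \<circ> inv' h"

context
  fixes h :: "nat \<Rightarrow> nat"
  assumes h: "h permutes {1..6}"
begin

lemma relabel_comp: "relabel h x \<circ> relabel h y = relabel h (x \<circ> y)"
  using permutes_inverses(2)[OF h] by (simp add: relabel_def fun_eq_iff)

lemma relabel_id: "relabel h id = id"
  using permutes_inverses(1)[OF h] by (simp add: relabel_def fun_eq_iff)

lemma relabel_eq_iff: "relabel h x = relabel h y \<longleftrightarrow> x = y"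
proof
  assume "relabel h x = relabel h y"
  then have "inv' h (relabel h x (h k)) = inv' h (relabel h y (h k))" for k by simp
  then show "x = y" using permutes_inverses(2)[OF h] by (simp add: relabel_def fun_eq_iff)
qed simp

lemma relabel_in_A6: "x \<in> carrier A6 \<Longrightarrow> relabel h x \<in> carrier A6"
proof -
  assume x: "x \<in> carrier A6"
  have perm: "permutation h" "permutation (inv' h)" "permutation x"
    using h permutes_inv[OF h] x by (auto simp: permutation_permutes alt_group_carrier)
  have "evenperm (h \<circ> x \<circ> inv' h)"
    using x perm by (simp add: evenperm_comp evenperm_inv permutation_compose alt_group_carrier)
  moreover have "h \<circ> x \<circ> inv' h permutes {1..6}"
    using x h by (auto simp: alt_group_carrier intro!: permutes_compose permutes_inv)
  ultimately show ?thesis by (simp add: relabel_def alt_group_carrier)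
qed

end

lemma conj_by_A6: "h \<in> carrier A6 \<Longrightarrow> conj_by A6 h x = relabel h x"
  by (simp add: conj_by_def relabel_def alt_group_mult alt_group_inv_equality)

lemma eq_on_sixI:
  fixes f g :: "nat \<Rightarrow> nat"
  assumes "f 1 = g 1" "f 2 = g 2" "f 3 = g 3" "f 4 = g 4" "f 5 = g 5" "f 6 = g 6"
    and "\<And>i. i \<notin> {1, 2, 3, 4, 5, 6} \<Longrightarrow> f i = g i"
  shows "f = g"
proof
  fix i
  show "f i = g i" using assms by (cases "i \<in> {1, 2, 3, 4, 5, 6}") auto
qed

text \<open>The equation says that k conjugates r to its inverse. Each witness reverses every cycle
  of r; where one transposition would do, the second commutes with r and restores evenness.\<close>

lemma alt6_rep_real:
  assumes "r \<in> alt6_reps"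
  shows "\<exists>k\<in>carrier A6. r \<circ> (k \<circ> r) = k"
proof -
  consider "r = id" | "r = cycle_of_list [1, 2] \<circ> cycle_of_list [3, 4]" | "r = cycle_of_list [1, 2, 3]"
    | "r = cycle_of_list [1, 2, 3] \<circ> cycle_of_list [4, 5, 6]" | "r = cycle_of_list [1, 2, 3, 4, 5]" | "r = pi_perm"
    using assms by blast
  then show ?thesis
  proof cases
    case 1
    then show ?thesis using A6.one_closed by (intro bexI[of _ id]) (auto simp: alt_group_one)
  next
    case 2
    have "r \<circ> (swap 1 2 \<circ> swap 3 4 \<circ> r) = swap 1 2 \<circ> swap 3 4"
      by (rule eq_on_sixI) (simp_all add: 2 Transposition.transpose_def)
    then show ?thesis by (intro bexI[of _ "swap 1 2 \<circ> swap 3 4"] two_swaps_in_A6) auto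
  next
    case 3
    have "r \<circ> (swap 1 2 \<circ> swap 4 5 \<circ> r) = swap 1 2 \<circ> swap 4 5"
      by (rule eq_on_sixI) (simp_all add: 3 Transposition.transpose_def)
    then show ?thesis by (intro bexI[of _ "swap 1 2 \<circ> swap 4 5"] two_swaps_in_A6) auto
  next
    case 4
    have "r \<circ> (swap 1 2 \<circ> swap 4 5 \<circ> r) = swap 1 2 \<circ> swap 4 5"
      by (rule eq_on_sixI) (simp_all add: 4 Transposition.transpose_def)
    then show ?thesis by (intro bexI[of _ "swap 1 2 \<circ> swap 4 5"] two_swaps_in_A6) auto
  next
    case 5
    have "r \<circ> (swap 2 5 \<circ> swap 3 4 \<circ> r) = swap 2 5 \<circ> swap 3 4"
      by (rule eq_on_sixI) (simp_all add: 5 Transposition.transpose_def)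
    then show ?thesis by (intro bexI[of _ "swap 2 5 \<circ> swap 3 4"] two_swaps_in_A6) auto
  next
    case 6
    have "r \<circ> (swap 1 2 \<circ> swap 4 6 \<circ> r) = swap 1 2 \<circ> swap 4 6"
      by (rule eq_on_sixI) (simp_all add: 6 pi_perm_def Transposition.transpose_def)
    then show ?thesis by (intro bexI[of _ "swap 1 2 \<circ> swap 4 6"] two_swaps_in_A6) auto
  qed
qed

lemma funpow_numerals: "f ^^ 3 = f \<circ> (f \<circ> f)" "f ^^ 5 = f \<circ> (f \<circ> (f \<circ> (f \<circ> f)))"
  by (simp_all add: eval_nat_numeral)

text \<open>These types cannot carry the scalar -1, whose odd powers differ from 1.\<close>

lemma alt6_rep_odd_order:
  assumes "r \<in> {id, cycle_of_list [1, 2, 3], cycle_of_list [1, 2, 3] \<circ> cycle_of_list [4, 5, 6], cycle_of_list [1, 2, 3, 4, 5::nat]}"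
  shows "\<exists>n. odd n \<and> r ^^ n = id"
proof -
  have "(cycle_of_list [1, 2, 3] :: nat \<Rightarrow> nat) ^^ 3 = id"
    "(cycle_of_list [1, 2, 3] \<circ> cycle_of_list [4, 5, 6] :: nat \<Rightarrow> nat) ^^ 3 = id"
    "(cycle_of_list [1, 2, 3, 4, 5] :: nat \<Rightarrow> nat) ^^ 5 = id"
    unfolding funpow_numerals
    by (rule eq_on_sixI; simp add: Transposition.transpose_def)+
  moreover have "odd (3::nat)" "odd (5::nat)" by simp_all
  moreover have "(id :: nat \<Rightarrow> nat) ^^ 3 = id" by simp
  ultimately show ?thesis using assms by blast
qed

lemma pow_A6: "x \<in> carrier A6 \<Longrightarrow> x [^]\<^bsub>A6\<^esub> (n::nat) = x ^^ n"
proof (induction n)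
  case (Suc n)
  then show ?case using A6.nat_pow_Suc2[of x n] by (simp add: alt_group_mult)
qed (simp add: alt_group_one)

lemma relabel_funpow:
  assumes "h permutes {1..6}"
  shows "relabel h x ^^ n = relabel h (x ^^ n)"
proof (induction n)
  case 0
  then show ?case using relabel_id[OF assms] by (simp add: id_def)
next
  case (Suc n)
  then show ?case using relabel_comp[OF assms, of x "x ^^ n"] by (simp add: comp_def)
qed

lemma (in yd_module) scalar_pow:
  assumes "\<And>w. \<rho> s *v w = q *s w"
  shows "s [^] (n::nat) \<in> centralizer G s \<and> \<rho> (s [^] n) *v w = q ^ n *s w"
proof (induction n)
  case 0
  then show ?case by (simp add: centralizer_one rep_one)
next
  case (Suc n)
  then show ?case by (simp add: rep_mult centralizer_self centralizer_mult vector_scalar_commute assms mult.commute)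
qed

lemma finite_dim_imp_pi:
  fixes s :: "nat \<Rightarrow> nat" and \<rho> :: "(nat \<Rightarrow> nat) \<Rightarrow> complex^'n^'n"
  assumes s: "s \<in> carrier A6" and irr: "irreducible_rep (centralizer_group A6 s) \<rho>"
    and trans: "conj_transversal A6 s g"
    and fin: "nichols_finite_dim (yd_basis A6 s) (yd_braiding A6 s g \<rho>)"
  shows "(\<exists>h\<in>carrier A6. s = conj_by A6 h pi_perm) \<and> (\<forall>w. \<rho> s *v w = - w)"
proof -
  interpret yd: yd_module A6 s g \<rho>
    by unfold_locales (use s irr trans finite_A6 in \<open>auto simp: irreducible_rep_def\<close>)
  obtain q where q: "q \<noteq> 0" "\<And>w. \<rho> s *v w = q *s w"
    using yd.scalar_of_irreducible[OF irr] by blast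
  obtain h r where h: "h permutes {1..6}" and r: "r \<in> alt6_reps" and sr: "s = relabel h r"
    using alt6_cycle_type[of s] s unfolding alt_group_carrier relabel_def by blast
  note rl = relabel_comp[OF h] relabel_eq_iff[OF h] relabel_in_A6[OF h]
  obtain k where k: "k \<in> carrier A6" "r \<circ> (k \<circ> r) = k" using alt6_rep_real[OF r] by blast
  have real: "inv\<^bsub>A6\<^esub> s \<in> conj_class A6 s"
  proof -
    have kc: "relabel h k \<in> carrier A6" using k rl by blast
    have "s \<otimes>\<^bsub>A6\<^esub> (relabel h k \<otimes>\<^bsub>A6\<^esub> s) = relabel h k"
      by (simp add: alt_group_mult sr rl k(2))
    then have "relabel h k \<otimes>\<^bsub>A6\<^esub> s = inv\<^bsub>A6\<^esub> s \<otimes>\<^bsub>A6\<^esub> relabel h k"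
      using kc s by (metis A6.inv_mult_cancel(1) A6.m_closed)
    then have "inv\<^bsub>A6\<^esub> s = relabel h k \<otimes>\<^bsub>A6\<^esub> s \<otimes>\<^bsub>A6\<^esub> inv\<^bsub>A6\<^esub> (relabel h k)"
      using kc s by (simp add: A6.m_assoc)
    then show ?thesis using kc by (auto simp: yd.conj_class_iff)
  qed
  have "q\<^sup>2 = 1"
    using yd.infinite_dim_real[OF q(2) real _ q(1)] fin by blast
  moreover have "q \<noteq> 1"
    using yd.infinite_dim_trivial q(2) fin by auto
  ultimately have "q = - 1" by (simp add: power2_eq_1_iff)
  then have neg: "\<rho> s *v w = - w" for w using q(2) by simp
  have "r ^^ n \<noteq> id" if "odd n" for n
  proof
    assume "r ^^ n = id"
    then have "s [^]\<^bsub>A6\<^esub> n = \<one>\<^bsub>A6\<^esub>"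
      using s by (simp add: pow_A6 sr relabel_funpow[OF h] relabel_id[OF h] alt_group_one)
    then have "w = - w" for w :: "complex^'n"
      using yd.scalar_pow[OF q(2), of n w] yd.rep_one[of w] that \<open>q = - 1\<close> by simp
    from arg_cong[OF this[of "axis undefined 1"], of "\<lambda>w. w $ undefined"] show False by simp
  qed
  then have "r \<notin> {id, cycle_of_list [1, 2, 3], cycle_of_list [1, 2, 3] \<circ> cycle_of_list [4, 5, 6], cycle_of_list [1, 2, 3, 4, 5]}"
    using alt6_rep_odd_order[of r] by blast
  then consider "r = swap 1 2 \<circ> swap 3 4" | "r = pi_perm" using r by auto
  then have "\<exists>h\<in>carrier A6. s = conj_by A6 h pi_perm"
  proof cases
    case 1
    define x1 x2 x3 where x: "x1 = swap 1 2 \<circ> swap 3 4" "x2 = swap 1 3 \<circ> swap 2 4" "x3 = swap 1 4 \<circ> swap 2 3"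
    \<comment> \<open>Conjugation by \<open>y1\<close> fixes \<open>x1\<close> and swaps
      \<open>x2\<close> with \<open>x3\<close>, and so on cyclically; the transposition of 5 and 6
      makes these elements even.\<close>
    define y1 y2 y3 where y: "y1 = swap 1 2 \<circ> swap 5 6" "y2 = swap 1 3 \<circ> swap 5 6" "y3 = swap 1 4 \<circ> swap 5 6"
    have xc: "x1 \<in> carrier A6" "x2 \<in> carrier A6" "x3 \<in> carrier A6"
      and yc: "y1 \<in> carrier A6" "y2 \<in> carrier A6" "y3 \<in> carrier A6"
      unfolding x y by (rule two_swaps_in_A6; simp)+
    have prod: "x1 \<circ> x1 = id" "x2 \<circ> x2 = id" "x3 \<circ> x3 = id" "x1 \<circ> x2 = x3" "x2 \<circ> x3 = x1" "x3 \<circ> x1 = x2"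
      "x2 \<circ> x1 = x3" "x3 \<circ> x2 = x1" "x1 \<circ> x3 = x2"
      unfolding x by (rule eq_on_sixI; simp add: Transposition.transpose_def)+
    have comm: "y1 \<circ> x1 = x1 \<circ> y1" "y1 \<circ> x2 = x3 \<circ> y1" "y2 \<circ> x2 = x2 \<circ> y2" "y2 \<circ> x3 = x1 \<circ> y2"
      "y3 \<circ> x3 = x3 \<circ> y3" "y3 \<circ> x1 = x2 \<circ> y3"
      unfolding x y by (rule eq_on_sixI; simp add: Transposition.transpose_def)+
    have dist: "distinct [x1, x2, x3]"
    proof -
      have "x1 1 = 2" "x2 1 = 3" "x3 1 = 4" unfolding x by (auto simp: Transposition.transpose_def)
      then show ?thesis by auto
    qed
    have conj: "b \<in> conj_class A6 s"
      if a: "a \<in> conj_class A6 s" and k: "k \<in> carrier A6" and kab: "k \<circ> a = b \<circ> k" and b: "b \<in> carrier A6"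
      for a b k
    proof -
      obtain l where l: "l \<in> carrier A6" "a = l \<otimes>\<^bsub>A6\<^esub> s \<otimes>\<^bsub>A6\<^esub> inv\<^bsub>A6\<^esub> l"
        using a unfolding yd.conj_class_iff by blast
      have "k \<otimes>\<^bsub>A6\<^esub> a = b \<otimes>\<^bsub>A6\<^esub> k" using kab by (simp only: alt_group_mult)
      then have "b = k \<otimes>\<^bsub>A6\<^esub> a \<otimes>\<^bsub>A6\<^esub> inv\<^bsub>A6\<^esub> k"
        using b k by (simp add: A6.m_assoc)
      also have "\<dots> = (k \<otimes>\<^bsub>A6\<^esub> l) \<otimes>\<^bsub>A6\<^esub> s \<otimes>\<^bsub>A6\<^esub> inv\<^bsub>A6\<^esub> (k \<otimes>\<^bsub>A6\<^esub> l)"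
        using k l s by (simp add: A6.m_assoc A6.inv_mult_group)
      finally show ?thesis
        using k l A6.m_closed unfolding yd.conj_class_iff by blast
    qed
    have s1: "s = relabel h x1" using 1 sr x by simp
    have cl1: "relabel h x1 \<in> conj_class A6 s" using yd.conj_class_self s1 by simp
    have cl2: "relabel h x2 \<in> conj_class A6 s"
      by (rule conj[OF cl1, of "relabel h y3"]) (simp_all add: rl comm xc yc)
    have cl3: "relabel h x3 \<in> conj_class A6 s"
      by (rule conj[OF cl2, of "relabel h y1"]) (simp_all add: rl comm xc yc)
    have "\<not> nichols_finite_dim (yd_basis A6 s) (yd_braiding A6 s g \<rho>)"
      by (rule yd.infinite_dim_triangle[OF neg cl1 cl2 cl3, of "relabel h y1" "relabel h y2" "relabel h y3"])
        (use dist in \<open>simp_all add: alt_group_mult alt_group_one rl relabel_id[OF h] prod comm yc\<close>)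
    then show ?thesis using fin by blast
  next
    case 2
    show ?thesis
    proof (cases "evenperm h")
      case True
      then have hc: "h \<in> carrier A6" using h by (simp add: alt_group_carrier)
      have "s = conj_by A6 h pi_perm"
        unfolding conj_by_A6[OF hc] by (simp only: 2 sr)
      then show ?thesis using hc by blast
    next
      case False
      \<comment> \<open>The transposition of 1 and 2 commutes with \<open>pi_perm\<close>, so it
        corrects an odd conjugator to an even one: this class does not split in the alternating
        group.\<close>
      define k where "k = h \<circ> swap 1 2"
      have "permutation h" unfolding permutation_permutes using h by blast
      then have "evenperm k"
        using False unfolding k_def by (simp add: evenperm_comp permutation_swap_id evenperm_swap)
      moreover have "k permutes {1..6}"
        unfolding k_def using h by (intro permutes_compose permutes_swap_id) auto
      ultimately have k: "k \<in> carrier A6" by (simp add: alt_group_carrier)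
      have "inv' k = swap 1 2 \<circ> inv' h"
        unfolding k_def using permutes_bij[OF h] by (subst o_inv_distrib) (auto simp: inv_transpose_eq)
      moreover have "swap 1 2 \<circ> pi_perm \<circ> swap 1 2 = pi_perm"
      proof -
        have "pi_perm = swap 1 2 \<circ> cycle_of_list [3, 4, 5, 6]"
          by (simp add: pi_perm_def)
        moreover have "swap 1 2 \<circ> cycle_of_list [3, 4, 5, 6] = cycle_of_list [3, 4, 5, 6] \<circ> swap 1 2"
          using cycles_commute[of "[1, 2]" "[3, 4, 5, 6::nat]"] by simp
        ultimately show ?thesis
          by (metis comp_assoc comp_id transpose_comp_involutory)
      qed
      then have "h \<circ> (swap 1 2 \<circ> pi_perm \<circ> swap 1 2) \<circ> inv' h = relabel h pi_perm"
        by (simp only: relabel_def)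
      ultimately have "relabel k pi_perm = relabel h pi_perm"
        unfolding k_def by (simp only: relabel_def[of "h \<circ> swap 1 2"] comp_assoc)
      then have "s = conj_by A6 k pi_perm"
        unfolding conj_by_A6[OF k] by (simp only: 2 sr)
      then show ?thesis using k by blast
    qed
  qed
  then show ?thesis using neg by blast
qed

section \<open>The centralizer of the exceptional element\<close>

lemma pi_perm_values:
  "pi_perm 1 = 2" "pi_perm (Suc 0) = 2" "pi_perm 2 = 1" "pi_perm 3 = 4" "pi_perm 4 = 5" "pi_perm 5 = 6" "pi_perm 6 = 3"
  by (simp_all add: pi_perm_def Transposition.transpose_def)

lemma pi_perm_in_A6: "pi_perm \<in> carrier A6"
proof -
  have "pi_perm = (swap 1 2 \<circ> swap 3 4) \<circ> (swap 4 5 \<circ> swap 5 6)"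
    by (simp add: pi_perm_def comp_assoc)
  moreover have "swap 1 2 \<circ> swap 3 4 \<in> carrier A6" "swap 4 5 \<circ> swap 5 6 \<in> carrier A6"
    by (rule two_swaps_in_A6; simp)+
  ultimately show ?thesis using A6.m_closed[unfolded alt_group_mult] by metis
qed

definition pi_powers :: "(nat \<Rightarrow> nat) set" where
  "pi_powers = {id, pi_perm, pi_perm \<circ> pi_perm, pi_perm \<circ> (pi_perm \<circ> pi_perm)}"

text \<open>By commutation x is determined by its values at 1 and 3, one letter from each cycle of
  \<open>pi_perm\<close>; this leaves two times four possibilities.\<close>

lemma commutes_pi_perm:
  assumes x: "x permutes {1..6}" and comm: "x \<circ> pi_perm = pi_perm \<circ> x"
  shows "x \<in> pi_powers \<union> (\<lambda>y. y \<circ> swap 1 2) ` pi_powers"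
proof -
  have c: "x (pi_perm i) = pi_perm (x i)" for i using comm by (metis comp_apply)
  have v: "x 2 = pi_perm (x 1)" "x 4 = pi_perm (x 3)" "x 5 = pi_perm (x 4)" "x 6 = pi_perm (x 5)"
    using c[of 1] c[of 3] c[of 4] c[of 5] by (simp_all add: pi_perm_values)
  have range: "x i \<in> {1, 2, 3, 4, 5, 6}" if "i \<in> {1, 2, 3, 4, 5, 6}" for i
  proof -
    have *: "{1..6} = {1, 2, 3, 4, 5, 6::nat}" by auto
    show ?thesis using permutes_in_image[OF x, of i] that unfolding * by blast
  qed
  have inj: "x i = x j \<longleftrightarrow> i = j" for i j
    using permutes_inj[OF x] by (auto dest: injD)
  have out: "x i = i" if "i \<notin> {1, 2, 3, 4, 5, 6}" for i
    by (rule permutes_not_in[OF x]) (use that in auto)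
  \<comment> \<open>If \<open>x 3\<close> were 1 or 2, then \<open>x 5\<close>, obtained from it by
    applying \<open>pi_perm\<close> twice, would equal \<open>x 3\<close>.\<close>
  have "x 3 \<noteq> x 5" using inj by simp
  then have x3: "x 3 \<in> {3, 4, 5, 6}"
    using range[of 3] v by (auto simp: pi_perm_values)
  have "x 1 \<noteq> x 3" "x 1 \<noteq> x 4" "x 1 \<noteq> x 5" "x 1 \<noteq> x 6" using inj by simp_all
  then have x1: "x 1 \<in> {1, 2}"
    using range[of 1] x3 v by (auto simp: pi_perm_values)
  have eqI: "x = y" if "\<And>i. i \<in> {1, 2, 3, 4, 5, 6} \<Longrightarrow> x i = y i" "\<And>i. i \<notin> {1, 2, 3, 4, 5, 6} \<Longrightarrow> y i = i" for y
    using that out by (metis ext)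
  have pi_out: "pi_perm i = i" if "i \<notin> {1, 2, 3, 4, 5, 6}" for i
    using that by (simp add: pi_perm_def Transposition.transpose_def)
  consider "x 1 = 1" "x 3 = 3" | "x 1 = 2" "x 3 = 4" | "x 1 = 1" "x 3 = 5" | "x 1 = 2" "x 3 = 6"
    | "x 1 = 2" "x 3 = 3" | "x 1 = 1" "x 3 = 4" | "x 1 = 2" "x 3 = 5" | "x 1 = 1" "x 3 = 6"
    using x1 x3 by blast
  then have "x = id \<or> x = pi_perm \<or> x = pi_perm \<circ> pi_perm \<or> x = pi_perm \<circ> (pi_perm \<circ> pi_perm) \<or>
    x = id \<circ> swap 1 2 \<or> x = pi_perm \<circ> swap 1 2 \<or> x = pi_perm \<circ> pi_perm \<circ> swap 1 2 \<or>
    x = pi_perm \<circ> (pi_perm \<circ> pi_perm) \<circ> swap 1 2"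
  proof cases
    case 1
    then have "x = id" by (intro eqI) (auto simp: v pi_perm_values)
    then show ?thesis by blast
  next
    case 2
    then have "x = pi_perm" by (intro eqI) (auto simp: v pi_perm_values pi_out)
    then show ?thesis by blast
  next
    case 3
    then have "x = pi_perm \<circ> pi_perm" by (intro eqI) (auto simp: v pi_perm_values pi_out)
    then show ?thesis by blast
  next
    case 4
    then have "x = pi_perm \<circ> (pi_perm \<circ> pi_perm)" by (intro eqI) (auto simp: v pi_perm_values pi_out)
    then show ?thesis by blast
  next
    case 5
    then have "x = id \<circ> swap 1 2" by (intro eqI) (auto simp: v pi_perm_values pi_out Transposition.transpose_def)
    then show ?thesis by blast
  next
    case 6
    then have "x = pi_perm \<circ> swap 1 2" by (intro eqI) (auto simp: v pi_perm_values pi_out Transposition.transpose_def)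
    then show ?thesis by blast
  next
    case 7
    then have "x = pi_perm \<circ> pi_perm \<circ> swap 1 2"
      by (intro eqI) (auto simp: v pi_perm_values pi_out Transposition.transpose_def)
    then show ?thesis by blast
  next
    case 8
    then have "x = pi_perm \<circ> (pi_perm \<circ> pi_perm) \<circ> swap 1 2"
      by (intro eqI) (auto simp: v pi_perm_values pi_out Transposition.transpose_def)
    then show ?thesis by blast
  qed
  then show ?thesis by (auto simp: pi_powers_def)
qed

lemma pi_powers_in_A6: "pi_powers \<subseteq> carrier A6"
  using pi_perm_in_A6 A6.m_closed[unfolded alt_group_mult] A6.one_closed
  by (auto simp: pi_powers_def alt_group_one)

text \<open>Of the eight commuting permutations, the four with the extra factor (1 2) are
  odd.\<close>

lemma centralizer_pi_perm: "centralizer A6 pi_perm = pi_powers"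
proof (intro equalityI subsetI)
  fix x
  assume "x \<in> centralizer A6 pi_perm"
  then have x: "x permutes {1..6}" "evenperm x" "x \<circ> pi_perm = pi_perm \<circ> x"
    by (auto simp: centralizer_def alt_group_carrier alt_group_mult)
  have "x \<noteq> y \<circ> swap 1 2" if "y \<in> pi_powers" for y
  proof
    assume "x = y \<circ> swap 1 2"
    moreover have "evenperm y" "permutation y"
      using that pi_powers_in_A6 alt_group_carrier'[of y 6] by (auto simp: alt_group_carrier)
    ultimately show False
      using x(2) by (simp add: evenperm_comp permutation_swap_id evenperm_swap)
  qed
  then show "x \<in> pi_powers" using commutes_pi_perm[OF x(1,3)] by blast
next
  fix x
  assume x: "x \<in> pi_powers"
  then have "x \<circ> pi_perm = pi_perm \<circ> x" by (auto simp: pi_powers_def comp_assoc)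
  then show "x \<in> centralizer A6 pi_perm"
    using x pi_powers_in_A6 by (auto simp: centralizer_def alt_group_mult)
qed

lemma centralizer_pi_perm_generate: "centralizer A6 pi_perm = generate A6 {pi_perm}"
proof
  show "centralizer A6 pi_perm \<subseteq> generate A6 {pi_perm}"
    using generate.one[of A6 "{pi_perm}"] generate.incl[of pi_perm "{pi_perm}" A6]
      generate.eng[of _ A6 "{pi_perm}"]
    by (auto simp: centralizer_pi_perm pi_powers_def alt_group_one alt_group_mult)
  show "generate A6 {pi_perm} \<subseteq> centralizer A6 pi_perm"
    by (rule A6.generate_subgroup_incl[OF _ A6.subgroup_centralizer])
      (auto simp: centralizer_pi_perm pi_powers_def pi_perm_in_A6)
qed

lemma pi_powers_cases:
  assumes "x \<in> pi_powers"
  obtains "x = id" | "x = pi_perm" | "x = pi_perm \<circ> pi_perm" | "x = pi_perm \<circ> (pi_perm \<circ> pi_perm)"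
  using assms by (auto simp: pi_powers_def)

lemma centralizer_pi_perm_iso: "centralizer_group A6 pi_perm \<cong> integer_mod_group 4"
proof -
  \<comment> \<open>The k-th power of \<open>pi_perm\<close> sends 3 to 3 + k for k = 0, ..., 3, so
    this reads off the exponent.\<close>
  let ?f = "\<lambda>x :: nat \<Rightarrow> nat. int (x 3) - 3"
  have "?f \<in> hom (centralizer_group A6 pi_perm) (integer_mod_group 4)"
  proof (rule homI)
    fix x y
    assume "x \<in> carrier (centralizer_group A6 pi_perm)" "y \<in> carrier (centralizer_group A6 pi_perm)"
    then show "?f (x \<otimes>\<^bsub>centralizer_group A6 pi_perm\<^esub> y) = ?f x \<otimes>\<^bsub>integer_mod_group 4\<^esub> ?f y"
      by (auto simp: centralizer_pi_perm alt_group_mult pi_perm_values elim!: pi_powers_cases)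
  qed (auto simp: centralizer_pi_perm carrier_integer_mod_group pi_perm_values elim!: pi_powers_cases)
  moreover have "bij_betw ?f pi_powers {0, 1, 2, 3}"
    unfolding bij_betw_def inj_on_def
    by (auto simp: pi_powers_def pi_perm_values)
  moreover have "{0, 1, 2, 3} = {0..<4::int}" by auto
  ultimately have "?f \<in> iso (centralizer_group A6 pi_perm) (integer_mod_group 4)"
    by (simp add: iso_def centralizer_pi_perm carrier_integer_mod_group)
  then show ?thesis by (auto simp: is_iso_def)
qed

text \<open>A power of \<open>pi_perm\<close> fixes 1 exactly if its exponent is even, so on the
  centralizer this is -1 to the exponent.\<close>

definition pi_sgn :: "(nat \<Rightarrow> nat) \<Rightarrow> complex" where
  "pi_sgn x = (if x 1 = 1 then 1 else - 1)"

lemma pi_sgn_hom: "pi_sgn \<in> hom (centralizer_group A6 pi_perm) complex_units"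
proof (rule homI)
  fix x y
  assume "x \<in> carrier (centralizer_group A6 pi_perm)" "y \<in> carrier (centralizer_group A6 pi_perm)"
  then show "pi_sgn (x \<otimes>\<^bsub>centralizer_group A6 pi_perm\<^esub> y) = pi_sgn x \<otimes>\<^bsub>complex_units\<^esub> pi_sgn y"
    using pi_perm_values
    by (auto simp: centralizer_pi_perm alt_group_mult complex_units_def pi_sgn_def elim!: pi_powers_cases)
qed (auto simp: complex_units_def pi_sgn_def)

text \<open>The centralizer of s consists of powers of s and therefore acts by scalars. Every line
  is then invariant, and irreducibility forces a single coordinate.\<close>

lemma equivalent_sgn:
  fixes \<rho> :: "(nat \<Rightarrow> nat) \<Rightarrow> complex^'n^'n"
  assumes irr: "irreducible_rep (centralizer_group A6 s) \<rho>" and s: "s \<in> carrier A6"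
    and neg: "\<And>w. \<rho> s *v w = - w" and h: "h \<in> carrier A6" "conj_by A6 h pi_perm = s"
  shows "equivalent_reps (centralizer_group A6 pi_perm) (\<lambda>x. \<rho> (conj_by A6 h x)) (\<lambda>x. mat (pi_sgn x) :: complex^1^1)"
proof -
  have hp: "h permutes {1..6}" using h by (simp add: alt_group_carrier)
  have sr: "s = relabel h pi_perm" using h by (simp add: conj_by_A6)
  have rep: "\<rho> \<in> hom (centralizer_group A6 s) GL_group" using irr by (simp add: irreducible_rep_def)
  have cs: "id \<in> centralizer A6 s" "s \<in> centralizer A6 s" "s \<circ> s \<in> centralizer A6 s"
    using A6.subgroup_centralizer[OF s] s unfolding alt_group_one[symmetric, of 6] alt_group_mult[symmetric, of 6]
    by (auto simp: centralizer_def A6.m_assoc)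
  have mult: "\<rho> (x \<circ> y) *v w = \<rho> x *v (\<rho> y *v w)" if "x \<in> centralizer A6 s" "y \<in> centralizer A6 s" for x y w
    using hom_GL_group_mult[OF rep, of x y] that by (simp add: alt_group_mult)
  have one: "\<rho> id *v w = w" for w
    using hom_GL_group_idem[OF rep, of id] cs by (simp add: alt_group_mult)
  have scalar: "\<rho> (conj_by A6 h x) *v w = pi_sgn x *s w" if "x \<in> pi_powers" for x w
  proof -
    have eq: "conj_by A6 h x = relabel h x" by (rule conj_by_A6[OF h(1)])
    have pow: "relabel h id = id" "relabel h pi_perm = s" "relabel h (pi_perm \<circ> pi_perm) = s \<circ> s"
      "relabel h (pi_perm \<circ> (pi_perm \<circ> pi_perm)) = s \<circ> (s \<circ> s)"
      using relabel_id[OF hp] by (simp_all only: sr relabel_comp[OF hp])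
    from that show ?thesis
      unfolding eq by (rule pi_powers_cases) (simp_all add: pow mult cs one neg pi_sgn_def pi_perm_values)
  qed
  have all: "\<exists>c. \<forall>w. \<rho> y *v w = c *s w" if "y \<in> centralizer A6 s" for y
  proof -
    define x where "x = relabel (inv' h) y"
    have hi: "inv' h permutes {1..6}" by (rule permutes_inv[OF hp])
    have y: "y \<in> carrier A6" "y \<circ> s = s \<circ> y" using that by (auto simp: centralizer_def alt_group_mult)
    have "relabel (inv' h) s = pi_perm"
      using permutes_inverses(2)[OF hp] by (simp add: sr relabel_def fun_eq_iff permutes_inv_inv[OF hp])
    then have "x \<circ> pi_perm = pi_perm \<circ> x"
      unfolding x_def using y(2) relabel_comp[OF hi] by metis
    moreover have "x \<in> carrier A6" unfolding x_def by (rule relabel_in_A6[OF hi y(1)])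
    ultimately have "x \<in> pi_powers"
      unfolding centralizer_pi_perm[symmetric] by (simp add: centralizer_def alt_group_mult)
    moreover have "conj_by A6 h x = y"
      using permutes_inverses(1)[OF hp] conj_by_A6[OF h(1)]
      by (simp add: x_def relabel_def fun_eq_iff permutes_inv_inv[OF hp])
    ultimately show ?thesis using scalar[of x] by auto
  qed
  have one_dim: "i = j" for i j :: 'n
  proof -
    let ?W = "range (\<lambda>c. c *s axis i (1::complex))"
    have "vec.subspace ?W"
      unfolding vec.subspace_def
      by (auto simp: image_iff vector_sadd_rdistrib[symmetric] vector_smult_assoc simp del: vector_sadd_rdistrib)
    moreover have "\<forall>y\<in>centralizer A6 s. \<forall>v\<in>?W. \<rho> y *v v \<in> ?W"
      using all by (force simp: vector_smult_assoc)
    ultimately have "?W = {0} \<or> ?W = UNIV"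
      using irr unfolding irreducible_rep_def by simp
    moreover have "1 *s axis i (1::complex) \<in> ?W" by blast
    then have "?W \<noteq> {0}" by (metis axis_eq_0_iff singletonD vector_smult_lid zero_neq_one)
    ultimately have "?W = UNIV" by blast
    then obtain c where "axis j (1::complex) = c *s axis i 1" by (metis UNIV_I imageE)
    then have "axis j (1::complex) $ j = c * axis i 1 $ j" by simp
    then show "i = j" by (auto simp: axis_def split: if_splits)
  qed
  obtain i0 :: 'n where U: "UNIV = {i0}" using one_dim by blast
  \<comment> \<open>Between spaces with one coordinate each, the all-ones matrix is the 1 by 1
    identity.\<close>
  define P :: "complex^'n^1" where "P = (\<chi> i j. 1)"
  define Q :: "complex^1^'n" where "Q = (\<chi> i j. 1)"
  have "P ** Q = mat 1" "Q ** P = mat 1"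
    using one_dim by (auto simp: P_def Q_def matrix_matrix_mult_def mat_def vec_eq_iff U)
  moreover have "P ** \<rho> (conj_by A6 h x) = mat (pi_sgn x) ** P" if "x \<in> pi_powers" for x
  proof -
    have "\<rho> (conj_by A6 h x) $ i $ j = pi_sgn x" for i j
    proof -
      have "(\<rho> (conj_by A6 h x) *v (\<chi> k. 1)) $ i = pi_sgn x"
        using scalar[OF that, of "\<chi> k. 1"] by simp
      then show ?thesis using one_dim[of j i0] by (simp add: matrix_vector_mult_def U)
    qed
    then show ?thesis
      by (simp add: P_def matrix_matrix_mult_def mat_def vec_eq_iff U)
  qed
  ultimately show ?thesis
    unfolding equivalent_reps_def by (auto simp: centralizer_pi_perm)
qed

lemma conj_class_eq:
  assumes "h \<in> carrier A6" "t \<in> carrier A6"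
  shows "conj_class A6 (conj_by A6 h t) = conj_class A6 t"
proof -
  have comp: "conj_by A6 k (conj_by A6 h t) = conj_by A6 (k \<otimes>\<^bsub>A6\<^esub> h) t" if "k \<in> carrier A6" for k
    using that assms by (simp add: conj_by_def A6.m_assoc A6.inv_mult_group)
  show ?thesis
  proof (intro equalityI subsetI)
    fix x assume "x \<in> conj_class A6 (conj_by A6 h t)"
    then obtain k where "k \<in> carrier A6" "x = conj_by A6 k (conj_by A6 h t)"
      by (auto simp: conj_class_def orbit_def)
    then show "x \<in> conj_class A6 t"
      using comp assms by (auto simp: conj_class_def orbit_def)
  next
    fix x assume "x \<in> conj_class A6 t"
    then obtain k where k: "k \<in> carrier A6" "x = conj_by A6 k t"
      by (auto simp: conj_class_def orbit_def)
    then have "x = conj_by A6 (k \<otimes>\<^bsub>A6\<^esub> inv\<^bsub>A6\<^esub> h) (conj_by A6 h t)"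
      using comp[of "k \<otimes>\<^bsub>A6\<^esub> inv\<^bsub>A6\<^esub> h"] assms by (simp add: A6.m_assoc)
    then show "x \<in> conj_class A6 (conj_by A6 h t)"
      using k assms by (auto simp: conj_class_def orbit_def)
  qed
qed

text \<open>As \<rho> lives on the centralizer of s, it is compared with the sign character after
  transport along a conjugator; the equality of the classes guarantees that some h
  qualifies.\<close>

theorem theorem2p7:
  fixes s :: "nat \<Rightarrow> nat"
    and g :: "(nat \<Rightarrow> nat) \<Rightarrow> (nat \<Rightarrow> nat)"
    and \<rho> :: "(nat \<Rightarrow> nat) \<Rightarrow> complex^'n^'n"
  assumes "s \<in> carrier (alt_group 6)"
    and "irreducible_rep (centralizer_group (alt_group 6) s) \<rho>"
    and "conj_transversal (alt_group 6) s g"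
    and "nichols_finite_dim (yd_basis (alt_group 6) s) (yd_braiding (alt_group 6) s g \<rho>)"
  shows "conj_class (alt_group 6) s = conj_class (alt_group 6) pi_perm
    \<and> centralizer (alt_group 6) pi_perm = generate (alt_group 6) {pi_perm}
    \<and> centralizer_group (alt_group 6) pi_perm \<cong> integer_mod_group 4
    \<and> (\<exists>sgn_char. sgn_char \<in> hom (centralizer_group (alt_group 6) pi_perm) complex_units
        \<and> sgn_char pi_perm = -1
        \<and> (\<forall>h\<in>carrier (alt_group 6). conj_by (alt_group 6) h pi_perm = s \<longrightarrow>
             equivalent_reps (centralizer_group (alt_group 6) pi_perm)
               (\<lambda>x. \<rho> (conj_by (alt_group 6) h x))
               (\<lambda>x. mat (sgn_char x) :: complex^1^1)))"
proof -
  obtain k where k: "k \<in> carrier A6" "s = conj_by A6 k pi_perm" and neg: "\<And>w. \<rho> s *v w = - w"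
    using finite_dim_imp_pi[OF assms] by blast
  have "conj_class A6 s = conj_class A6 pi_perm"
    unfolding k(2) by (rule conj_class_eq[OF k(1) pi_perm_in_A6])
  moreover have "pi_sgn pi_perm = -1"
    using pi_perm_values by (simp add: pi_sgn_def)
  ultimately show ?thesis
    using centralizer_pi_perm_generate centralizer_pi_perm_iso pi_sgn_hom
      equivalent_sgn[OF assms(2,1) neg] by blast
qed

end
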